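(* Let $\mathbb K\in\{\mathbb R,\mathbb C\}$, put $\eta_{\mathbb R}=1$, $\eta_{\mathbb C}=2$, let $p,q,d,k$ be positive integers and $\varepsilon,\delta\in(0,1)$. Let $\Sigma\in\mathbb R^{k\times p}$, $\Omega\in\mathbb R^{k\times q}$ and $\Gamma\in\mathbb R^{k\times k^2}$ be independently drawn from rescaled Gaussian distributions, with $$k\ \ge\ 168\,\varepsilon^{-2}\big(6.9\,\eta_{\mathbb K}\,d+\log(6/\delta)\big).$$ Then $\Upsilon:\mathbb K^{q\times p}\to\mathbb K^k$, $\Upsilon(X):=\Gamma\,\mathrm{vec}(\Omega X\Sigma^* )$, is a $(\varepsilon,\delta,d)$ oblivious $\mathbb K^{q\times p}\to\mathbb K^k$ subspace embedding.
   Context: A $k\times n$ rescaled Gaussian matrix has i.i.d. real Gaussian entries with mean $0$ and variance $1/k$. $M^*$ is the conjugate transpose and $\mathrm{vec}$ stacks the columns of a matrix into a vector. $\mathbb K^n$ carries its canonical inner product and $\mathbb K^{q\times p}$ the Frobenius inner product $\langle X,Y\rangle_F=\mathrm{Tr}(X^*Y)$. For a finite-dimensional inner product space $Z$ over $\mathbb K$, a random linear map $\Theta:Z\to\mathbb K^k$ is called a $(\varepsilon,\delta,d)$ oblivious $Z\to\mathbb K^k$ subspace embedding if for every (deterministic) subspace $Z_d\subset Z$ with $\dim Z_d=d$, $$\mathbb P\big(\forall x,y\in Z_d:\ |\langle x,y\rangle_Z-\langle\Theta(x),\Theta(y)\rangle_2|\le\varepsilon\|x\|_Z\|y\|_Z\big)\ge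 1-\delta .$$ *)

theory Defs
  imports
    "HOL-Probability.Probability"
    "Jordan_Normal_Form.Conjugate"
begin

text \<open>
  The scalar field is a type of sort \<open>{conjugatable_field, real_normed_field}\<close>, of which
  \<^typ>\<open>real\<close> (with the identity as \<^const>\<open>conjugate\<close>) and \<^typ>\<open>complex\<close>
  (with \<^const>\<open>cnj\<close>) are the intended instances. The library's \<open>inner\<close> on
  \<open>complex ^ 'n\<close> is the real inner product, hence the definitions below.
\<close>

definition canonical_inner ::
    "'a::conjugatable_field ^ 'n \<Rightarrow> 'a ^ 'n \<Rightarrow> 'a" where
  "canonical_inner x y = (\<Sum>i\<in>UNIV. conjugate (x $ i) * y $ i)"

definition conj_transpose ::
    "'a::conjugatable_field ^ 'n ^ 'm \<Rightarrow> 'a ^ 'm ^ 'n" where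
  "conj_transpose A = map_matrix conjugate (transpose A)"

definition frobenius_inner ::
    "'a::conjugatable_field ^ 'p ^ 'q \<Rightarrow> 'a ^ 'p ^ 'q \<Rightarrow> 'a" where
  "frobenius_inner X Y = trace (conj_transpose X ** Y)"

definition mat_scale :: "'a::times \<Rightarrow> 'a ^ 'p ^ 'q \<Rightarrow> 'a ^ 'p ^ 'q" where
  "mat_scale c X = map_matrix (\<lambda>a. c * a) X"

text \<open>
  The norm induced by an inner product; \<open>ip x x\<close> is a nonnegative real element of
  the scalar field, so its absolute value is its real value.
\<close>

definition induced_norm ::
    "('z \<Rightarrow> 'z \<Rightarrow> 'a::real_normed_field) \<Rightarrow> 'z \<Rightarrow> real" where
  "induced_norm ip x = sqrt (norm (ip x x))"

text \<open>
  The entry of \<open>vec_cols X\<close> at position \<open>(j, i)\<close> is the \<open>i\<close>-th entry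
  of the \<open>j\<close>-th column of \<open>X\<close>: the index set of the stacked vector is the set of
  pairs (column, row), in lexicographic order.
\<close>

definition vec_cols :: "'a ^ 'n ^ 'm \<Rightarrow> 'a ^ ('n \<times> 'm)" where
  "vec_cols X = (\<chi> c. X $ snd c $ fst c)"

context prob_space
begin

text \<open>
  The second parameter of \<^const>\<open>normal_density\<close> is the standard deviation, so the
  variance is \<open>1 / k\<close> with \<open>k\<close> the number of rows.
\<close>

definition rescaled_gaussian :: "('a \<Rightarrow> real ^ 'n ^ 'k) \<Rightarrow> bool" where
  "rescaled_gaussian A \<longleftrightarrow>
     indep_vars (\<lambda>_. borel) (\<lambda>(i, j) \<omega>. A \<omega> $ i $ j) UNIV \<and>
     (\<forall>i j. distributed M lborel (\<lambda>\<omega>. A \<omega> $ i $ j)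
              (normal_density 0 (sqrt (1 / real CARD('k)))))"

text \<open>
  Mutual independence of three random variables with values in different spaces, which
  \<^const>\<open>indep_vars\<close> does not cover.
\<close>

definition indep_three ::
    "('a \<Rightarrow> 'x::topological_space) \<Rightarrow> ('a \<Rightarrow> 'y::topological_space) \<Rightarrow>
     ('a \<Rightarrow> 'z::topological_space) \<Rightarrow> bool" where
  "indep_three X Y Z \<longleftrightarrow>
     random_variable borel X \<and> random_variable borel Y \<and> random_variable borel Z \<and>
     indep_sets
       (\<lambda>i. [{X -` A \<inter> space M |A. A \<in> sets borel},
             {Y -` A \<inter> space M |A. A \<in> sets borel},
             {Z -` A \<inter> space M |A. A \<in> sets borel}] ! i)
       {0, 1, 2}"

text \<open>
  The space \<open>Z\<close> is given by its scalar multiplication and its inner product. The first two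
  conjuncts say that \<open>\<Theta>\<close> is a random linear map. A non-measurable event has measure
  \<open>0\<close> in the library, so for \<open>\<delta> < 1\<close> the last conjunct includes
  measurability of the event.
\<close>

definition oblivious_subspace_embedding ::
    "('s::{conjugatable_field, real_normed_field} \<Rightarrow> 'z::ab_group_add \<Rightarrow> 'z) \<Rightarrow>
     ('z \<Rightarrow> 'z \<Rightarrow> 's) \<Rightarrow> real \<Rightarrow> real \<Rightarrow> nat \<Rightarrow>
     ('a \<Rightarrow> 'z \<Rightarrow> 's ^ 'k) \<Rightarrow> bool" where
  "oblivious_subspace_embedding sc ip \<epsilon> \<delta> d \<Theta> \<longleftrightarrow>
     (\<forall>\<omega>\<in>space M. Vector_Spaces.linear sc (*s) (\<Theta> \<omega>)) \<and>
     (\<forall>x. random_variable borel (\<lambda>\<omega>. \<Theta> \<omega> x)) \<and>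
     (\<forall>V. module.subspace sc V \<and> vector_space.dim sc V = d \<longrightarrow>
        \<P>(\<omega> in M. \<forall>x\<in>V. \<forall>y\<in>V.
            norm (ip x y - canonical_inner (\<Theta> \<omega> x) (\<Theta> \<omega> y))
              \<le> \<epsilon> * induced_norm ip x * induced_norm ip y) \<ge> 1 - \<delta>)"

end

definition kron_sketch ::
    "real ^ 'p ^ 'k \<Rightarrow> real ^ 'q ^ 'k \<Rightarrow> real ^ ('k \<times> 'k) ^ 'k \<Rightarrow>
     'a::{conjugatable_field, real_normed_field} ^ 'p ^ 'q \<Rightarrow> 'a ^ 'k" where
  "kron_sketch S W G X =
     map_matrix of_real G *v
       vec_cols (map_matrix of_real W ** X ** conj_transpose (map_matrix of_real S))"

end

theory Submission
  imports Defs
begin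

text \<open>
  Why the theorem holds. The sketch is a composition of three Gaussian stages: \<open>\<Sigma>\<close> acts on
  the rows of \<open>X\<close>, \<open>\<Omega>\<close> on the columns of the result, and \<open>\<Gamma>\<close> on the stacked vector.
  Fix \<open>X\<close>. In each stage a \<open>k\<close>-rowed rescaled Gaussian matrix \<open>A\<close> is applied to a finite
  family of real vectors \<open>x i\<close> (real and imaginary parts of rows or columns), and the squared norm of
  the result is a convex combination, with weights proportional to \<open>(norm (x i))\<^sup>2\<close>, of
  \<open>\<chi>\<^sup>2\<close>-variables with \<open>k\<close> degrees of freedom divided by \<open>k\<close>. These variables are dependent, but
  by convexity of the exponential the moment generating function of the combination is at most that of a
  single one. So the family obeys the usual Johnson--Lindenstrauss bound: relative deviation more than
  \<open>e\<close> has probability at most \<open>2 * exp (- k * e\<^sup>2 / 8)\<close>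
  (\<open>rescaled_gaussian_concentration\<close>).

  A stage is independent of the previous ones, so its bound may be used with their outcome held fixed.
  With relative error \<open>\<epsilon> / 4\<close> per stage the errors compound to
  \<open>(1 + \<epsilon> / 4) ^ 3 - 1 \<le> 61 / 64 * \<epsilon>\<close>, which fails with probability at most
  \<open>6 * exp (- k * \<epsilon>\<^sup>2 / 128)\<close> (\<open>real_kron_sketch_concentration\<close>); the factor
  \<open>6\<close> is the one in \<open>log (6 / \<delta>)\<close>.

  To pass from one \<open>X\<close> to a subspace of real dimension \<open>m\<close>, take a \<open>1 / 50\<close>-net of its unit
  ball with at most \<open>(101 * exp 1) ^ m \<le> exp (6.9 * m)\<close> points (\<open>subspace_ball_net\<close>). A union
  bound over the net is affordable under the hypothesis on \<open>k\<close>, and the quadratic form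
  \<open>(norm x)\<^sup>2 - (norm (T x))\<^sup>2\<close> being at most \<open>61 / 64 * \<epsilon>\<close> in absolute value
  on the net bounds the bilinear form by \<open>\<epsilon>\<close> on the whole subspace (\<open>inner_defect_le_of_net\<close>).

  All of this is real linear algebra: only the real inner product on matrices enters. A complex subspace of
  dimension \<open>d\<close> is a real one of dimension at most \<open>2 * d\<close>, whence the factor
  \<open>\<eta> = 2\<close>, and the complex inequality follows from its real part by multiplying \<open>y\<close> with a
  unimodular scalar (\<open>hermitian_defect_le_iff\<close>).
\<close>

section \<open>Concentration for a Gaussian matrix\<close>

text \<open>
  The coefficient \<open>1\<close> of \<open>s\<^sup>2\<close> is what yields the constant \<open>1 / 8\<close> in the
  exponent \<open>- k * e\<^sup>2 / 8\<close> of the tail bound. Both signs of \<open>s\<close> are covered so that upper and lower tails share one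
  argument.
\<close>

lemma ln_one_minus_ge:
  fixes s :: real
  assumes "\<bar>s\<bar> \<le> 1/2"
  shows "- s - s\<^sup>2 \<le> ln (1 - s)"
proof (cases "s \<le> 0")
  case True
  then show ?thesis using ln_one_plus_pos_lower_bound[of "- s"] assms by simp
next
  case False
  have "ln (1 - 0) + 0 + 0\<^sup>2 \<le> ln (1 - s) + s + s\<^sup>2"
  proof (rule DERIV_nonneg_imp_nondecreasing[where f = "\<lambda>x. ln (1 - x) + x + x\<^sup>2"])
    fix x assume x: "0 \<le> x" "x \<le> s"
    then have x12: "x \<le> 1/2" using assms by linarith
    have "((\<lambda>x. ln (1 - x) + x + x\<^sup>2) has_real_derivative (- 1 / (1 - x) + 1 + 2 * x)) (at x)"
      using x12 by (auto intro!: derivative_eq_intros)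
    moreover have "- 1 / (1 - x) + 1 + 2 * x = x * (1 - 2 * x) / (1 - x)"
      using x12 by (simp add: field_simps)
    ultimately show "\<exists>y. ((\<lambda>x. ln (1 - x) + x + x\<^sup>2) has_real_derivative y) (at x) \<and> 0 \<le> y"
      using x x12
      by (intro exI[of _ "- 1 / (1 - x) + 1 + 2 * x"] conjI) simp_all
  qed (use False in simp)
  then show ?thesis by simp
qed

text \<open>
  Multiplying the standard normal density by \<open>exp (s * x\<^sup>2 / 2)\<close> gives, up to the factor
  \<open>\<tau>\<close>, the centred normal density of variance \<open>\<tau>\<^sup>2 = 1 / (1 - s)\<close>; hence the integral
  is \<open>\<tau>\<close> itself.
\<close>

lemma (in prob_space) nn_integral_exp_square_std_normal_le:
  assumes X: "distributed M lborel X std_normal_density" and s: "\<bar>s\<bar> \<le> 1/2"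
  shows "(\<integral>\<^sup>+\<omega>. ennreal (exp (s * (X \<omega>)\<^sup>2 / 2)) \<partial>M) \<le> ennreal (exp ((s + s\<^sup>2) / 2))"
proof -
  define \<tau> where "\<tau> = 1 / sqrt (1 - s)"
  have s1: "1 - s > 0" using s by linarith
  have \<tau>: "\<tau> > 0" "\<tau>\<^sup>2 = 1 / (1 - s)" using s1 by (auto simp: \<tau>_def power_divide)
  have dens: "std_normal_density x * exp (s * x\<^sup>2 / 2) = \<tau> * normal_density 0 \<tau> x" for x :: real
  proof -
    have "sqrt (2 * pi * \<tau>\<^sup>2) = sqrt (2 * pi) * \<tau>"
      using \<tau>(1) by (simp add: real_sqrt_mult)
    moreover have "- x\<^sup>2 / 2 + s * x\<^sup>2 / 2 = - x\<^sup>2 / (2 * \<tau>\<^sup>2)"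
      using s1 by (simp add: \<tau>(2) field_simps)
    ultimately show ?thesis
      using \<tau> by (simp add: normal_density_def flip: exp_add)
  qed
  have "(\<integral>\<^sup>+\<omega>. ennreal (exp (s * (X \<omega>)\<^sup>2 / 2)) \<partial>M) =
      (\<integral>\<^sup>+x. ennreal (std_normal_density x) * ennreal (exp (s * x\<^sup>2 / 2)) \<partial>lborel)"
    by (rule distributed_nn_integral[OF X, symmetric]) simp
  also have "\<dots> = (\<integral>\<^sup>+x. ennreal \<tau> * ennreal (normal_density 0 \<tau> x) \<partial>lborel)"
    using \<tau> by (simp add: dens normal_density_nonneg flip: ennreal_mult)
  also have "\<dots> = ennreal \<tau>"
    using \<tau> by (simp add: nn_integral_cmult nn_integral_eq_integral normal_density_nonneg)
  also have "\<tau> = exp (- ln (1 - s) / 2)"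
    using s1 by (simp add: \<tau>_def ln_sqrt exp_minus inverse_eq_divide flip: ln_sqrt)
  also have "ennreal \<dots> \<le> ennreal (exp ((s + s\<^sup>2) / 2))"
    using ln_one_minus_ge[OF s] by (intro ennreal_leI) simp
  finally show ?thesis .
qed


context prob_space
begin

lemma rescaled_gaussian_entry_std_normal:
  fixes A :: "'a \<Rightarrow> real ^ 'n ^ 'k"
  assumes A: "rescaled_gaussian A" and v: "norm v = 1"
  shows "distributed M lborel (\<lambda>\<omega>. sqrt (real CARD('k)) * (A \<omega> *v v) $ l) std_normal_density"
proof -
  let ?k = "real CARD('k)"
  \<comment> \<open>A degenerate summand has no density, so the zero coordinates of \<open>v\<close> are left out.\<close>
  define J where "J = {j. v $ j \<noteq> 0}"
  define X where "X j \<omega> = sqrt ?k * v $ j * A \<omega> $ l $ j" for j \<omega>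
  have k: "?k > 0" by simp
  have ind: "indep_vars (\<lambda>_. borel) (\<lambda>(i, j) \<omega>. A \<omega> $ i $ j) UNIV"
    and dist: "distributed M lborel (\<lambda>\<omega>. A \<omega> $ i $ j) (normal_density 0 (sqrt (1 / ?k)))" for i j
    using A by (auto simp: rescaled_gaussian_def)
  have "indep_vars (\<lambda>_. borel) (\<lambda>j \<omega>. A \<omega> $ l $ j) J"
  proof -
    have "indep_vars (\<lambda>j. PiM {(l, j)} (\<lambda>_. borel))
        (\<lambda>j \<omega>. restrict (\<lambda>i. (\<lambda>(i, j) \<omega>. A \<omega> $ i $ j) i \<omega>) {(l, j)}) J"
      by (intro indep_vars_restrict[OF ind]) (auto simp: disjoint_family_on_def)
    then have "indep_vars (\<lambda>_. borel)
        (\<lambda>j \<omega>. restrict (\<lambda>i. (\<lambda>(i, j) \<omega>. A \<omega> $ i $ j) i \<omega>) {(l, j)} (l, j)) J"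
      by (rule indep_vars_compose2) (rule measurable_component_singleton, simp)
    then show ?thesis by simp
  qed
  then have indX: "indep_vars (\<lambda>_. borel) X J"
    unfolding X_def by (rule indep_vars_compose2) simp
  have distX: "distributed M lborel (X j) (normal_density 0 \<bar>v $ j\<bar>)" if "j \<in> J" for j
    using normal_density_affine[OF dist[of l j], of "sqrt ?k * v $ j" 0] that k
    by (simp add: X_def[abs_def] J_def abs_mult real_sqrt_divide)
  have "v \<noteq> 0" using v by auto
  then have "J \<noteq> {}" by (auto simp: J_def vec_eq_iff)
  then have "distributed M lborel (\<lambda>\<omega>. \<Sum>j\<in>J. X j \<omega>)
      (normal_density (\<Sum>j\<in>J. 0) (sqrt (\<Sum>j\<in>J. \<bar>v $ j\<bar>\<^sup>2)))"
    by (intro sum_indep_normal indX distX) (auto simp: J_def)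
  moreover have "(\<Sum>j\<in>J. \<bar>v $ j\<bar>\<^sup>2) = (norm v)\<^sup>2"
    unfolding norm_vec_def L2_set_def J_def
    by (subst real_sqrt_pow2) (auto intro!: sum.mono_neutral_left sum_nonneg)
  moreover have "(\<Sum>j\<in>J. X j \<omega>) = sqrt ?k * (A \<omega> *v v) $ l" for \<omega>
    unfolding X_def J_def matrix_vector_mult_def vec_lambda_beta sum_distrib_left
    by (auto intro!: sum.mono_neutral_cong_left)
  ultimately show ?thesis using v by simp
qed

lemma indep_rescaled_gaussian_rows:
  fixes A :: "'a \<Rightarrow> real ^ 'n ^ 'k"
  assumes "rescaled_gaussian A"
  shows "indep_vars (\<lambda>_. borel) (\<lambda>l \<omega>. (A \<omega> *v v) $ l) UNIV"
proof -
  let ?X = "\<lambda>(i, j) \<omega>. A \<omega> $ i $ j"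
  have "indep_vars (\<lambda>l. PiM ({l} \<times> UNIV) (\<lambda>_. borel))
      (\<lambda>l \<omega>. restrict (\<lambda>i. ?X i \<omega>) ({l} \<times> UNIV)) UNIV"
    using assms unfolding rescaled_gaussian_def
    by (intro indep_vars_restrict) (auto simp: disjoint_family_on_def)
  then have "indep_vars (\<lambda>_. borel)
      (\<lambda>l \<omega>. \<Sum>j\<in>UNIV. restrict (\<lambda>i. ?X i \<omega>) ({l} \<times> UNIV) (l, j) * v $ j) UNIV"
    by (rule indep_vars_compose2) measurable
  then show ?thesis
    by (simp add: matrix_vector_mult_def)
qed

lemma rescaled_gaussian_mgf_unit:
  fixes A :: "'a \<Rightarrow> real ^ 'n ^ 'k"
  assumes A: "rescaled_gaussian A" and v: "norm v = 1" and s: "\<bar>s\<bar> \<le> 1/2"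
  shows "(\<integral>\<^sup>+\<omega>. ennreal (exp (s * (real CARD('k) * (norm (A \<omega> *v v))\<^sup>2) / 2)) \<partial>M)
    \<le> ennreal (exp (real CARD('k) * (s + s\<^sup>2) / 2))"
proof -
  let ?k = "real CARD('k)"
  define Y where "Y l \<omega> = ennreal (exp (s * (sqrt ?k * (A \<omega> *v v) $ l)\<^sup>2 / 2))" for l \<omega>
  have "s * (?k * (norm (A \<omega> *v v))\<^sup>2) / 2 = (\<Sum>l\<in>UNIV. s * (sqrt ?k * (A \<omega> *v v) $ l)\<^sup>2 / 2)" for \<omega>
    by (simp add: norm_vec_def L2_set_def sum_nonneg power_mult_distrib sum_distrib_left
        sum_divide_distrib)
  then have "(\<integral>\<^sup>+\<omega>. ennreal (exp (s * (?k * (norm (A \<omega> *v v))\<^sup>2) / 2)) \<partial>M)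
      = (\<integral>\<^sup>+\<omega>. (\<Prod>l\<in>UNIV. Y l \<omega>) \<partial>M)"
    by (simp add: Y_def exp_sum prod_ennreal)
  also have "\<dots> = (\<Prod>l\<in>UNIV. \<integral>\<^sup>+\<omega>. Y l \<omega> \<partial>M)"
    unfolding Y_def
    by (intro indep_vars_nn_integral indep_vars_compose2[OF indep_rescaled_gaussian_rows[OF A]]) auto
  also have "\<dots> \<le> (\<Prod>l\<in>(UNIV :: 'k set). ennreal (exp ((s + s\<^sup>2) / 2)))"
    unfolding Y_def
    by (intro prod_mono_ennreal nn_integral_exp_square_std_normal_le
        rescaled_gaussian_entry_std_normal[OF A v] s)
  also have "\<dots> = ennreal (exp (?k * (s + s\<^sup>2) / 2))"
    by (simp add: ennreal_power exp_of_nat_mult[symmetric])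
  finally show ?thesis .
qed

lemma rescaled_gaussian_measurable:
  fixes A :: "'a \<Rightarrow> real ^ 'n ^ 'k"
  assumes "rescaled_gaussian A"
  shows "(\<lambda>\<omega>. A \<omega> *v v) \<in> borel_measurable M"
  using indep_rescaled_gaussian_rows[OF assms, of v]
  by (subst borel_measurable_euclidean_space)
    (auto simp: indep_vars_def Basis_vec_def inner_axis)

text \<open>
  The squared norm of the image of the family is the average, with weights \<open>(norm (x i))\<^sup>2\<close>, of the
  squared norms of the images of the unit vectors \<open>sgn (x i)\<close>. Jensen's inequality for the exponential
  reduces the bound to one unit vector, however the images depend on each other.
\<close>

lemma rescaled_gaussian_mgf_family:
  fixes A :: "'a \<Rightarrow> real ^ 'n ^ 'k" and x :: "'i \<Rightarrow> real ^ 'n"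
  assumes A: "rescaled_gaussian A" and s: "\<bar>s\<bar> \<le> 1/2"
    and I: "finite I" and x1: "(\<Sum>i\<in>I. (norm (x i))\<^sup>2) = 1"
  shows "(\<integral>\<^sup>+\<omega>. ennreal (exp (s * (real CARD('k) * (\<Sum>i\<in>I. (norm (A \<omega> *v x i))\<^sup>2)) / 2)) \<partial>M)
    \<le> ennreal (exp (real CARD('k) * (s + s\<^sup>2) / 2))"
proof -
  let ?k = "real CARD('k)" and ?e = "exp (real CARD('k) * (s + s\<^sup>2) / 2)"
  note [measurable] = rescaled_gaussian_measurable[OF A]
  define w where "w i = (norm (x i))\<^sup>2" for i
  define f where "f i \<omega> = exp (s * (?k * (norm (A \<omega> *v sgn (x i)))\<^sup>2) / 2)" for i \<omega>
  have [simp]: "I \<noteq> {}" using x1 by auto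
  have split: "s * (?k * (\<Sum>i\<in>I. (norm (A \<omega> *v x i))\<^sup>2)) / 2
      = (\<Sum>i\<in>I. w i *\<^sub>R (s * (?k * (norm (A \<omega> *v sgn (x i)))\<^sup>2) / 2))" for \<omega>
  proof -
    have "A \<omega> *v x i = norm (x i) *\<^sub>R (A \<omega> *v sgn (x i))" for i
      by (cases "x i = 0")
        (simp_all add: sgn_div_norm matrix_vector_mult_scaleR)
    then have "(norm (A \<omega> *v x i))\<^sup>2 = w i * (norm (A \<omega> *v sgn (x i)))\<^sup>2" for i
      by (simp add: w_def power_mult_distrib)
    then show ?thesis
      by (simp add: sum_distrib_left sum_divide_distrib mult_ac)
  qed
  have "exp (s * (?k * (\<Sum>i\<in>I. (norm (A \<omega> *v x i))\<^sup>2)) / 2) \<le> (\<Sum>i\<in>I. w i * f i \<omega>)" for \<omega>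
    unfolding split f_def using x1 I
    by (intro convex_on_sum[OF _ _ exp_convex]) (auto simp: w_def)
  then have "(\<integral>\<^sup>+\<omega>. ennreal (exp (s * (?k * (\<Sum>i\<in>I. (norm (A \<omega> *v x i))\<^sup>2)) / 2)) \<partial>M)
      \<le> (\<integral>\<^sup>+\<omega>. (\<Sum>i\<in>I. ennreal (w i) * ennreal (f i \<omega>)) \<partial>M)"
    by (intro nn_integral_mono)
      (simp add: w_def f_def ennreal_leI flip: ennreal_mult)
  also have "\<dots> = (\<Sum>i\<in>I. ennreal (w i) * (\<integral>\<^sup>+\<omega>. ennreal (f i \<omega>) \<partial>M))"
    unfolding f_def by (subst nn_integral_sum) (auto intro!: sum.cong nn_integral_cmult)
  also have "\<dots> \<le> (\<Sum>i\<in>I. ennreal (w i) * ennreal ?e)"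
  proof (rule sum_mono)
    fix i
    show "ennreal (w i) * (\<integral>\<^sup>+\<omega>. ennreal (f i \<omega>) \<partial>M) \<le> ennreal (w i) * ennreal ?e"
    proof (cases "x i = 0")
      case False
      then show ?thesis unfolding f_def
        by (intro mult_left_mono rescaled_gaussian_mgf_unit[OF A _ s]) (simp_all add: norm_sgn)
    qed (simp add: w_def)
  qed
  also have "\<dots> = ennreal ?e"
    using x1 by (simp add: w_def sum_ennreal flip: sum_distrib_right)
  finally show ?thesis .
qed

text \<open>
  One Chernoff bound for both tails: the sign of \<open>s\<close> decides whether the event is an upper or a lower
  deviation.
\<close>

lemma rescaled_gaussian_chernoff:
  fixes A :: "'a \<Rightarrow> real ^ 'n ^ 'k" and x :: "'i \<Rightarrow> real ^ 'n"
  assumes A: "rescaled_gaussian A" and s: "\<bar>s\<bar> \<le> 1/2"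
    and I: "finite I" and x1: "(\<Sum>i\<in>I. (norm (x i))\<^sup>2) = 1"
  shows "prob {\<omega> \<in> space M. s * (\<Sum>i\<in>I. (norm (A \<omega> *v x i))\<^sup>2) \<ge> s + r}
    \<le> exp (real CARD('k) * (s\<^sup>2 - r) / 2)"
proof -
  let ?k = "real CARD('k)" and ?S = "\<lambda>\<omega>. \<Sum>i\<in>I. (norm (A \<omega> *v x i))\<^sup>2"
  note [measurable] = rescaled_gaussian_measurable[OF A]
  let ?c = "ennreal (exp (- (?k * (s + r) / 2)))"
  have "{\<omega> \<in> space M. s * ?S \<omega> \<ge> s + r}
      = {\<omega> \<in> space M. 1 \<le> ?c * ennreal (exp (s * (?k * ?S \<omega>) / 2))}"
  proof (intro Collect_cong conj_cong refl)
    fix \<omega>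
    have "1 \<le> ?c * ennreal (exp (s * (?k * ?S \<omega>) / 2))
        \<longleftrightarrow> 0 \<le> - (?k * (s + r) / 2) + s * (?k * ?S \<omega>) / 2"
      by (simp flip: ennreal_mult exp_add add: ennreal_1[symmetric] del: ennreal_1)
    also have "- (?k * (s + r) / 2) + s * (?k * ?S \<omega>) / 2 = ?k / 2 * (s * ?S \<omega> - (s + r))"
      by (simp add: algebra_simps)
    also have "0 \<le> \<dots> \<longleftrightarrow> 0 \<le> ?k * (s * ?S \<omega> - (s + r))"
      by (simp add: zero_le_mult_iff)
    also have "\<dots> \<longleftrightarrow> s * ?S \<omega> \<ge> s + r"
      by (simp add: zero_le_mult_iff)
    finally show "(s * ?S \<omega> \<ge> s + r) = (1 \<le> ?c * ennreal (exp (s * (?k * ?S \<omega>) / 2)))" ..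
  qed
  then have "emeasure M {\<omega> \<in> space M. s * ?S \<omega> \<ge> s + r}
      \<le> ?c * (\<integral>\<^sup>+\<omega>. ennreal (exp (s * (?k * ?S \<omega>) / 2)) * indicator (space M) \<omega> \<partial>M)"
    using nn_integral_Markov_inequality[of "\<lambda>\<omega>. ennreal (exp (s * (?k * ?S \<omega>) / 2))" "space M" M ?c]
    by simp
  also have "\<dots> = ?c * (\<integral>\<^sup>+\<omega>. ennreal (exp (s * (?k * ?S \<omega>) / 2)) \<partial>M)"
    by (intro arg_cong2[where f="(*)"] refl nn_integral_cong) simp
  also have "\<dots> \<le> ?c * ennreal (exp (?k * (s + s\<^sup>2) / 2))"
    by (intro mult_left_mono rescaled_gaussian_mgf_family assms) simp
  also have "\<dots> = ennreal (exp (?k * (s\<^sup>2 - r) / 2))"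
    by (simp add: algebra_simps diff_divide_distrib add_divide_distrib flip: ennreal_mult exp_add)
  finally show ?thesis
    by (simp add: emeasure_eq_measure)
qed

text \<open>
  After normalising \<open>S\<close> to \<open>1\<close> the two tails are the Chernoff bounds at \<open>s = e / 2\<close> and
  \<open>s = - e / 2\<close>, with slack \<open>e * \<bar>s\<bar> = e\<^sup>2 / 2\<close>: the exponent
  \<open>s\<^sup>2 - e\<^sup>2 / 2\<close> is then \<open>- e\<^sup>2 / 4\<close>.
\<close>

lemma rescaled_gaussian_concentration:
  fixes A :: "'a \<Rightarrow> real ^ 'n ^ 'k" and x :: "'i \<Rightarrow> real ^ 'n"
  assumes A: "rescaled_gaussian A" and I: "finite I" and e: "0 < e" "e \<le> 1"
  defines "S \<equiv> \<Sum>i\<in>I. (norm (x i))\<^sup>2"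
  shows "prob {\<omega> \<in> space M. \<bar>(\<Sum>i\<in>I. (norm (A \<omega> *v x i))\<^sup>2) - S\<bar> > e * S}
    \<le> 2 * exp (- real CARD('k) * e\<^sup>2 / 8)"
proof (cases "S = 0")
  case True
  then have "x i = 0" if "i \<in> I" for i
    using that I by (simp add: S_def sum_nonneg_eq_0_iff)
  then have "{\<omega> \<in> space M. \<bar>(\<Sum>i\<in>I. (norm (A \<omega> *v x i))\<^sup>2) - S\<bar> > e * S} = {}"
    using True by simp
  then show ?thesis by (simp only: measure_empty) simp
next
  case False
  then have S: "S > 0" using sum_nonneg[of I "\<lambda>i. (norm (x i))\<^sup>2"] by (simp add: S_def)
  note [measurable] = rescaled_gaussian_measurable[OF A]
  define y where "y i = (1 / sqrt S) *\<^sub>R x i" for i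
  have y: "(norm (y i))\<^sup>2 = (norm (x i))\<^sup>2 / S"
    "(norm (A \<omega> *v y i))\<^sup>2 = (norm (A \<omega> *v x i))\<^sup>2 / S" for i \<omega>
    using S by (simp_all add: y_def matrix_vector_mult_scaleR power_mult_distrib power_divide)
  have y1: "(\<Sum>i\<in>I. (norm (y i))\<^sup>2) = 1"
    using S by (simp add: y S_def flip: sum_divide_distrib)
  define T where "T \<omega> = (\<Sum>i\<in>I. (norm (A \<omega> *v y i))\<^sup>2)" for \<omega>
  have T: "(\<Sum>i\<in>I. (norm (A \<omega> *v x i))\<^sup>2) = S * T \<omega>" for \<omega>
    using S by (simp add: T_def y flip: sum_divide_distrib)
  let ?E = "\<lambda>s. {\<omega> \<in> space M. s * T \<omega> \<ge> s + e\<^sup>2 / 2}"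
  have [measurable]: "T \<in> borel_measurable M" unfolding T_def by measurable
  have E: "prob (?E s) \<le> exp (- real CARD('k) * e\<^sup>2 / 8)" if "s = e / 2 \<or> s = - e / 2" for s
  proof -
    have "prob (?E s) \<le> exp (real CARD('k) * (s\<^sup>2 - e\<^sup>2 / 2) / 2)"
      unfolding T_def using that e by (intro rescaled_gaussian_chernoff A I y1) auto
    also have "s\<^sup>2 = e\<^sup>2 / 4" using that by (auto simp: power_divide)
    finally show ?thesis by simp
  qed
  have "prob {\<omega> \<in> space M. \<bar>(\<Sum>i\<in>I. (norm (A \<omega> *v x i))\<^sup>2) - S\<bar> > e * S}
      \<le> prob (?E (e / 2) \<union> ?E (- e / 2))"
  proof (rule finite_measure_mono)
    show "{\<omega> \<in> space M. \<bar>(\<Sum>i\<in>I. (norm (A \<omega> *v x i))\<^sup>2) - S\<bar> > e * S} \<subseteq> ?E (e / 2) \<union> ?E (- e / 2)"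
    proof safe
      fix \<omega> assume "\<bar>(\<Sum>i\<in>I. (norm (A \<omega> *v x i))\<^sup>2) - S\<bar> > e * S"
        and "\<not> - e / 2 * T \<omega> \<ge> - e / 2 + e\<^sup>2 / 2"
      moreover have "\<bar>S * T \<omega> - S\<bar> = S * \<bar>T \<omega> - 1\<bar>"
        using abs_mult[of S "T \<omega> - 1"] S by (simp add: right_diff_distrib)
      ultimately have "\<bar>T \<omega> - 1\<bar> > e" "e * (1 - T \<omega>) < e * e"
        using S by (simp_all only: T mult.commute[of e S] mult_less_cancel_left_pos)
          (simp add: power2_eq_square algebra_simps)
      then have "T \<omega> - 1 > e" using e by simp
      then have "e * (T \<omega> - 1) \<ge> e * e" using e by simp
      then show "e / 2 * T \<omega> \<ge> e / 2 + e\<^sup>2 / 2"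
        by (simp add: power2_eq_square algebra_simps)
    qed
  qed measurable
  also have "\<dots> \<le> prob (?E (e / 2)) + prob (?E (- e / 2))"
    by (rule measure_Un_le) measurable
  also have "\<dots> \<le> 2 * exp (- real CARD('k) * e\<^sup>2 / 8)"
    using E[of "e/2"] E[of "- e/2"] by simp
  finally show ?thesis .
qed

end

section \<open>Nets in a subspace\<close>

lemma truncate_to_int:
  fixes t :: real
  obtains z :: int where "\<bar>real_of_int z\<bar> \<le> \<bar>t\<bar>" "\<bar>t - real_of_int z\<bar> \<le> 1"
proof (cases "t \<ge> 0")
  case True
  then have "0 \<le> \<lfloor>t\<rfloor>" by simp
  with True show ?thesis by (intro that[of "\<lfloor>t\<rfloor>"]) linarith+
next
  case False
  then have "\<lceil>t\<rceil> \<le> 0" by simp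
  with False show ?thesis by (intro that[of "\<lceil>t\<rceil>"]) linarith+
qed

text \<open>
  The two-sided geometric series with ratio \<open>q = exp (- g)\<close> has the sum
  \<open>(1 + q) / (1 - q) = 1 + 2 / (exp g - 1)\<close>.
\<close>

lemma sum_exp_neg_abs_le:
  fixes g :: real
  assumes g: "g > 0"
  shows "(\<Sum>z = - int K..int K. exp (- g * \<bar>real_of_int z\<bar>)) \<le> 1 + 2 / g"
proof -
  let ?q = "exp (- g)"
  have closed: "(\<Sum>z = - int K..int K. exp (- g * \<bar>real_of_int z\<bar>)) * (1 - ?q) = 1 + ?q - 2 * ?q ^ Suc K"
  proof (induction K)
    case (Suc K)
    have "{- int (Suc K)..int (Suc K)} = insert (- int (Suc K)) (insert (int (Suc K)) {- int K..int K})"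
      by auto
    moreover have "exp (- g * real (Suc K)) = ?q ^ Suc K"
      by (metis exp_of_nat2_mult)
    then have "exp (- g * \<bar>real_of_int (int (Suc K))\<bar>) = ?q ^ Suc K"
      "exp (- g * \<bar>real_of_int (- int (Suc K))\<bar>) = ?q ^ Suc K"
      by (simp_all only: of_int_of_nat_eq of_int_minus abs_minus_cancel abs_of_nat)
    ultimately have "(\<Sum>z = - int (Suc K)..int (Suc K). exp (- g * \<bar>real_of_int z\<bar>))
        = (\<Sum>z = - int K..int K. exp (- g * \<bar>real_of_int z\<bar>)) + 2 * ?q ^ Suc K"
      by (simp del: of_nat_Suc power_Suc of_int_of_nat_eq)
    then have "(\<Sum>z = - int (Suc K)..int (Suc K). exp (- g * \<bar>real_of_int z\<bar>)) * (1 - ?q)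
        = (1 + ?q - 2 * ?q ^ Suc K) + 2 * ?q ^ Suc K * (1 - ?q)"
      using Suc.IH by (simp only: distrib_right)
    then show ?case by (simp add: algebra_simps)
  qed simp
  have q: "?q < 1" using g by simp
  have "(1 + g) * ?q \<le> exp g * ?q"
    by (intro mult_right_mono exp_ge_add_one_self_aux) (use g in auto)
  then have "g * ?q \<le> 1 - ?q" by (simp add: algebra_simps flip: exp_add)
  then have "2 * ?q \<le> 2 / g * (1 - ?q)" using g by (simp add: field_simps)
  then have "1 + ?q - 2 * ?q ^ Suc K \<le> (1 + 2 / g) * (1 - ?q)"
  proof -
    assume "2 * ?q \<le> 2 / g * (1 - ?q)"
    moreover have "(1 + 2 / g) * (1 - ?q) = 1 - ?q + 2 / g * (1 - ?q)"
      by (simp only: distrib_right mult_1_left)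
    moreover have "0 \<le> ?q ^ Suc K" by simp
    ultimately show ?thesis by linarith
  qed
  then show ?thesis using closed q by (metis diff_gt_0_iff_gt mult_le_cancel_right_pos)
qed

text \<open>
  Exponential counting: each admissible \<open>z\<close> contributes at least \<open>1\<close> to the sum of
  \<open>exp (g * (R - (\<Sum>b\<in>B. \<bar>z b\<bar>)))\<close>, and over the whole box this sum factors into
  geometric series. The cut-off \<open>K\<close> makes the box finite.
\<close>

lemma card_lattice_l1_ball_le:
  fixes g R :: real
  assumes g: "g > 0" and B: "finite B"
  shows "real (card {z \<in> B \<rightarrow>\<^sub>E {- int K..int K}. (\<Sum>b\<in>B. \<bar>real_of_int (z b)\<bar>) \<le> R})
    \<le> exp (g * R) * (1 + 2 / g) ^ card B"
proof -
  let ?P = "B \<rightarrow>\<^sub>E {- int K..int K}" and ?s = "\<lambda>z. \<Sum>b\<in>B. \<bar>real_of_int (z b)\<bar>"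
  let ?F = "{z \<in> ?P. ?s z \<le> R}"
  have fin: "finite ?P" using B by (intro finite_PiE) auto
  have "real (card ?F) = (\<Sum>z\<in>?F. 1)" by simp
  also have "\<dots> \<le> (\<Sum>z\<in>?F. exp (g * (R - ?s z)))"
    using g by (intro sum_mono) simp
  also have "\<dots> \<le> (\<Sum>z\<in>?P. exp (g * (R - ?s z)))"
    using fin by (intro sum_mono2) auto
  also have "\<dots> = exp (g * R) * (\<Sum>z\<in>?P. \<Prod>b\<in>B. exp (- g * \<bar>real_of_int (z b)\<bar>))"
    unfolding sum_distrib_left
    by (intro sum.cong refl)
      (simp add: right_diff_distrib sum_distrib_left sum_negf flip: exp_sum[OF B] exp_add)
  also have "\<dots> = exp (g * R) * (\<Prod>b\<in>B. \<Sum>z = - int K..int K. exp (- g * \<bar>real_of_int z\<bar>))"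
    by (subst prod_sum_PiE) (use B in auto)
  also have "\<dots> \<le> exp (g * R) * (\<Prod>b\<in>B. 1 + 2 / g)"
    by (intro mult_left_mono prod_mono conjI sum_exp_neg_abs_le[OF g] sum_nonneg) auto
  finally show ?thesis by simp
qed

lemma norm_orthonormal_combination:
  assumes "finite B" "pairwise orthogonal B" "\<And>b. b \<in> B \<Longrightarrow> norm b = 1"
  shows "(norm (\<Sum>b\<in>B. c b *\<^sub>R b))\<^sup>2 = (\<Sum>b\<in>B. (c b)\<^sup>2)"
proof -
  have "pairwise (\<lambda>i j. orthogonal (c i *\<^sub>R i) (c j *\<^sub>R j)) B"
    using assms(2) by (auto simp: pairwise_def orthogonal_def)
  then show ?thesis using assms by (simp add: norm_sum_Pythagorean)
qed

text \<open>
  The net is the lattice of mesh \<open>g / sqrt m\<close> in an orthonormal basis of \<open>V\<close>, cut down to the unit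
  ball. Rounding each coordinate of \<open>x\<close> towards \<open>0\<close> moves \<open>x\<close> by at most \<open>g\<close> and
  does not increase its norm. The Cauchy--Schwarz inequality puts the integer coordinates of the rounded
  point into the \<open>l\<^sub>1\<close>-ball of radius \<open>m / g\<close>, where lattice points can be counted by
  factorisation.
\<close>

lemma subspace_ball_net:
  fixes V :: "'a::euclidean_space set" and g :: real
  assumes V: "subspace V" and g: "g > 0"
  obtains N where "finite N" "N \<subseteq> V" "\<And>u. u \<in> N \<Longrightarrow> norm u \<le> 1"
    "real (card N) \<le> (exp 1 * (1 + 2 / g)) ^ dim V"
    "\<And>x. x \<in> V \<Longrightarrow> norm x \<le> 1 \<Longrightarrow> \<exists>u\<in>N. norm (x - u) \<le> g"
proof (cases "dim V = 0")
  case True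
  then have "V = {0}" using V subspace_0[OF V] dim_eq_0[of V] by blast
  then show ?thesis using g by (intro that[of "{0}"]) simp_all
next
  case False
  obtain B where B: "pairwise orthogonal B" "\<And>b. b \<in> B \<Longrightarrow> norm b = 1" "independent B"
    "card B = dim V" "span B = V" "B \<subseteq> V"
    using orthonormal_basis_subspace[OF V] by metis
  have fin: "finite B" using B(3) by (rule independent_imp_finite)
  have comb: "(norm (\<Sum>b\<in>B. c b *\<^sub>R b))\<^sup>2 = (\<Sum>b\<in>B. (c b)\<^sup>2)" for c
    using norm_orthonormal_combination[OF fin B(1)] B(2) by blast
  define m where "m = real (dim V)"
  have m: "m > 0" unfolding m_def using False by (simp only: of_nat_0_less_iff neq0_conv)
  define h where "h = g / sqrt m"
  have h: "h > 0" using g m by (simp add: h_def)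
  define R where "R = m / g"
  define K where "K = nat \<lceil>R\<rceil>"
  define F where "F = {z \<in> B \<rightarrow>\<^sub>E {- int K..int K}. (\<Sum>b\<in>B. \<bar>real_of_int (z b)\<bar>) \<le> R}"
  define p where "p z = (\<Sum>b\<in>B. (h * real_of_int (z b)) *\<^sub>R b)" for z :: "'a \<Rightarrow> int"
  define N where "N = p ` F \<inter> {u. norm u \<le> 1}"
  have finF: "finite F" unfolding F_def
    using finite_PiE[OF fin, of "\<lambda>_. {- int K..int K}"] by simp
  show ?thesis
  proof
    show "finite N" using finF by (simp add: N_def)
    show "N \<subseteq> V"
      unfolding N_def p_def using V B by (auto intro!: subspace_sum subspace_scale)
    show "norm u \<le> 1" if "u \<in> N" for u using that by (simp add: N_def)
    have "real (card N) \<le> real (card F)"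
      unfolding N_def using finF by (meson card_image_le card_mono finite_imageI inf_le1 le_trans of_nat_mono)
    also have "\<dots> \<le> exp (g * R) * (1 + 2 / g) ^ card B"
      unfolding F_def by (rule card_lattice_l1_ball_le[OF g fin])
    also have "exp (g * R) = exp 1 ^ card B"
      using g B(4) by (simp add: R_def m_def flip: exp_of_nat_mult)
    finally show "real (card N) \<le> (exp 1 * (1 + 2 / g)) ^ dim V"
      by (simp add: power_mult_distrib B(4))
    fix x assume x: "x \<in> V" "norm x \<le> 1"
    have x_eq: "(\<Sum>b\<in>B. (x \<bullet> b) *\<^sub>R b) = x"
      using B x fin by (intro orthonormal_basis_expand) auto
    have x2: "(\<Sum>b\<in>B. (x \<bullet> b)\<^sup>2) = (norm x)\<^sup>2"
      using comb[of "\<lambda>b. x \<bullet> b"] x_eq by simp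
    have "\<forall>b. \<exists>z::int. \<bar>real_of_int z\<bar> \<le> \<bar>x \<bullet> b / h\<bar> \<and> \<bar>x \<bullet> b / h - real_of_int z\<bar> \<le> 1"
      by (metis truncate_to_int)
    then obtain z0 :: "'a \<Rightarrow> int"
      where z0: "\<bar>real_of_int (z0 b)\<bar> \<le> \<bar>x \<bullet> b / h\<bar>" "\<bar>x \<bullet> b / h - real_of_int (z0 b)\<bar> \<le> 1" for b
      by metis
    define z where "z = restrict z0 B"
    have z: "\<bar>h * real_of_int (z b)\<bar> \<le> \<bar>x \<bullet> b\<bar>" "\<bar>x \<bullet> b - h * real_of_int (z b)\<bar> \<le> h"
      if "b \<in> B" for b
    proof -
      show "\<bar>h * real_of_int (z b)\<bar> \<le> \<bar>x \<bullet> b\<bar>"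
        using z0(1)[of b] h that by (simp add: z_def abs_mult field_simps)
      have "\<bar>x \<bullet> b - h * real_of_int (z b)\<bar> = h * \<bar>x \<bullet> b / h - real_of_int (z0 b)\<bar>"
        using h that abs_mult[of h "x \<bullet> b / h - real_of_int (z0 b)"]
        by (simp add: z_def right_diff_distrib)
      also have "\<dots> \<le> h" using z0(2)[of b] h by simp
      finally show "\<bar>x \<bullet> b - h * real_of_int (z b)\<bar> \<le> h" .
    qed
    have "(\<Sum>b\<in>B. \<bar>x \<bullet> b\<bar>)\<^sup>2 \<le> (\<Sum>b\<in>B. \<bar>x \<bullet> b\<bar>\<^sup>2) * (\<Sum>b\<in>B. 1\<^sup>2)"
      using Cauchy_Schwarz_ineq_sum[of "\<lambda>b. \<bar>x \<bullet> b\<bar>" "\<lambda>_. 1" B] by simp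
    also have "\<dots> = (norm x)\<^sup>2 * m" by (simp add: x2 B(4) m_def)
    also have "\<dots> \<le> m" using x m by (simp add: abs_square_le_1 mult_left_le_one_le)
    finally have "(\<Sum>b\<in>B. \<bar>x \<bullet> b\<bar>) \<le> sqrt m" by (rule real_le_rsqrt)
    then have "h * (\<Sum>b\<in>B. \<bar>real_of_int (z b)\<bar>) \<le> sqrt m"
      using sum_mono[of B "\<lambda>b. \<bar>h * real_of_int (z b)\<bar>" "\<lambda>b. \<bar>x \<bullet> b\<bar>"] z(1) h
      by (simp add: abs_mult sum_distrib_left)
    also have "sqrt m = h * R" using m g by (simp add: h_def R_def real_div_sqrt)
    finally have l1: "(\<Sum>b\<in>B. \<bar>real_of_int (z b)\<bar>) \<le> R" using h by simp
    have "z b \<in> {- int K..int K}" if "b \<in> B" for b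
    proof -
      have "\<bar>real_of_int (z b)\<bar> \<le> R"
        using l1 member_le_sum[OF that, of "\<lambda>b. \<bar>real_of_int (z b)\<bar>"] fin by simp
      then have "\<bar>z b\<bar> \<le> int K" unfolding K_def by linarith
      then show ?thesis by auto
    qed
    then have zF: "z \<in> F" using l1 by (auto simp: F_def z_def)
    have "(norm (p z))\<^sup>2 \<le> (norm x)\<^sup>2"
      unfolding p_def comb x2[symmetric]
      using z(1) by (intro sum_mono) (simp add: abs_le_square_iff)
    then have pz: "norm (p z) \<le> 1" using x by (meson norm_ge_zero order_trans power2_le_imp_le)
    have "x - p z = (\<Sum>b\<in>B. (x \<bullet> b - h * real_of_int (z b)) *\<^sub>R b)"
      unfolding p_def by (subst x_eq[symmetric]) (simp add: sum_subtractf scaleR_diff_left)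
    then have "(norm (x - p z))\<^sup>2 = (\<Sum>b\<in>B. (x \<bullet> b - h * real_of_int (z b))\<^sup>2)"
      by (simp only: comb)
    also have "\<dots> \<le> (\<Sum>b\<in>B. h\<^sup>2)"
      using z(2) h by (intro sum_mono) (simp add: abs_le_square_iff[symmetric])
    also have "\<dots> = g\<^sup>2" using m B(4) by (simp add: h_def power_divide flip: m_def)
    finally have "norm (x - p z) \<le> g" by (rule power2_le_imp_le) (use g in simp)
    then show "\<exists>u\<in>N. norm (x - u) \<le> g" using zF pz by (auto simp: N_def)
  qed
qed

text \<open>
  Let \<open>\<beta>\<close> be the maximum of the absolute value of the symmetric form \<open>Q\<close> on the unit sphere of
  \<open>V\<close>, attained at \<open>x0\<close>. By polarization \<open>\<beta>\<close> also bounds \<open>Q\<close> as a bilinear form. For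
  a net point \<open>u\<close> near \<open>x0\<close>, the identity \<open>Q x0 x0 = Q u u + Q (x0 - u) (x0 + u)\<close> gives
  \<open>\<beta> \<le> e + 2 * g * \<beta>\<close>, which is solved for \<open>\<beta>\<close>.
\<close>

lemma inner_defect_le_of_net:
  fixes V :: "'a::euclidean_space set" and T :: "'a \<Rightarrow> 'b::real_inner"
  assumes V: "subspace V" and T: "linear T"
    and N: "N \<subseteq> V" "\<And>u. u \<in> N \<Longrightarrow> norm u \<le> 1"
    and dense: "\<And>x. x \<in> V \<Longrightarrow> norm x \<le> 1 \<Longrightarrow> \<exists>u\<in>N. norm (x - u) \<le> g"
    and g: "2 * g < 1"
    and e: "\<And>u. u \<in> N \<Longrightarrow> \<bar>(norm (T u))\<^sup>2 - (norm u)\<^sup>2\<bar> \<le> e"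
    and xy: "x \<in> V" "y \<in> V"
  shows "\<bar>x \<bullet> y - T x \<bullet> T y\<bar> \<le> e / (1 - 2 * g) * norm x * norm y"
proof (cases "x = 0 \<or> y = 0")
  case True
  then show ?thesis using linear_0[OF T] by auto
next
  case False
  define Q where "Q a b = a \<bullet> b - T a \<bullet> T b" for a b
  have Qlin: "Q (a + b) c = Q a c + Q b c" "Q (a - b) c = Q a c - Q b c"
    "Q c (a + b) = Q c a + Q c b" "Q c (a - b) = Q c a - Q c b"
    "Q (r *\<^sub>R a) b = r * Q a b" "Q a (r *\<^sub>R b) = r * Q a b" "Q a b = Q b a" for a b c r
    by (simp_all add: Q_def linear_add[OF T] linear_diff[OF T] linear_cmul[OF T]
        inner_simps inner_commute right_diff_distrib)
  let ?S = "V \<inter> sphere 0 1"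
  have "compact ?S" using V by (simp add: closed_subspace closed_Int_compact)
  moreover have "x /\<^sub>R norm x \<in> ?S" using False xy V by (simp add: subspace_scale)
  moreover have "continuous_on ?S (\<lambda>x. \<bar>Q x x\<bar>)"
    unfolding Q_def by (intro continuous_intros linear_continuous_on) (simp_all add: T linear_conv_bounded_linear[symmetric])
  ultimately obtain x0 where x0: "x0 \<in> ?S" "\<And>a. a \<in> ?S \<Longrightarrow> \<bar>Q a a\<bar> \<le> \<bar>Q x0 x0\<bar>"
    using continuous_attains_sup[of ?S "\<lambda>x. \<bar>Q x x\<bar>"] by blast
  define \<beta> where "\<beta> = \<bar>Q x0 x0\<bar>"
  have quad: "\<bar>Q a a\<bar> \<le> \<beta> * (norm a)\<^sup>2" if "a \<in> V" for a
  proof (cases "a = 0")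
    case True
    then show ?thesis by (simp add: Q_def linear_0[OF T])
  next
    case False
    have "\<bar>Q (a /\<^sub>R norm a) (a /\<^sub>R norm a)\<bar> \<le> \<beta>"
      unfolding \<beta>_def using False that V by (intro x0(2)) (simp add: subspace_scale)
    then show ?thesis using False
      by (simp add: Qlin(5,6) abs_mult field_simps power2_eq_square)
  qed
  have bilin_unit: "\<bar>Q a b\<bar> \<le> \<beta>" if "a \<in> V" "b \<in> V" "norm a = 1" "norm b = 1" for a b
  proof -
    have "4 * Q a b = Q (a + b) (a + b) - Q (a - b) (a - b)"
      using Qlin(7)[of a b] by (simp add: Qlin(1-4))
    then have "4 * \<bar>Q a b\<bar> \<le> \<bar>Q (a + b) (a + b)\<bar> + \<bar>Q (a - b) (a - b)\<bar>" by linarith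
    also have "\<dots> \<le> \<beta> * (norm (a + b))\<^sup>2 + \<beta> * (norm (a - b))\<^sup>2"
      using that V by (intro add_mono quad) (simp_all add: subspace_add subspace_diff)
    also have "\<dots> = \<beta> * (2 * (norm a)\<^sup>2 + 2 * (norm b)\<^sup>2)"
      by (simp add: power2_norm_eq_inner inner_simps inner_commute algebra_simps)
    finally show ?thesis using that by simp
  qed
  have bilin: "\<bar>Q a b\<bar> \<le> \<beta> * norm a * norm b" if "a \<in> V" "b \<in> V" for a b
  proof (cases "a = 0 \<or> b = 0")
    case True
    then show ?thesis by (auto simp: Q_def linear_0[OF T])
  next
    case False
    have "\<bar>Q (a /\<^sub>R norm a) (b /\<^sub>R norm b)\<bar> \<le> \<beta>"
      using that V False by (intro bilin_unit) (auto simp: subspace_scale)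
    then show ?thesis using False
      by (simp add: Qlin(5,6) abs_mult field_simps)
  qed
  have x0V: "x0 \<in> V" "norm x0 = 1" using x0(1) by auto
  obtain u where u: "u \<in> N" "norm (x0 - u) \<le> g" using dense[of x0] x0V by auto
  have uV: "u \<in> V" "norm u \<le> 1" using u N by auto
  have "Q x0 x0 = Q u u + Q (x0 - u) (x0 + u)"
    using Qlin(7)[of u x0] by (simp add: Qlin(1-4))
  then have "\<beta> \<le> \<bar>Q u u\<bar> + \<bar>Q (x0 - u) (x0 + u)\<bar>" unfolding \<beta>_def by linarith
  also have "\<dots> \<le> e + \<beta> * norm (x0 - u) * norm (x0 + u)"
    using e[OF u(1)] uV x0V V
    by (intro add_mono bilin) (auto simp: Q_def power2_norm_eq_inner abs_minus_commute subspace_add subspace_diff)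
  also have "\<dots> \<le> e + \<beta> * g * 2"
    using u(2) norm_triangle_ineq[of x0 u] x0V uV order_trans[OF norm_ge_zero u(2)]
    by (intro add_left_mono mult_mono mult_left_mono) (auto simp: \<beta>_def intro: order_trans)
  finally have "\<beta> \<le> e / (1 - 2 * g)" using g by (simp add: field_simps)
  then have "\<beta> * (norm x * norm y) \<le> e / (1 - 2 * g) * (norm x * norm y)"
    by (intro mult_right_mono) auto
  then show ?thesis using bilin[OF xy] by (simp add: Q_def mult.assoc)
qed

section \<open>The sketch in real coordinates\<close>

text \<open>
  The product of a real matrix with a column whose entries lie in an arbitrary real vector space, here the
  scalar field seen as a Euclidean space. This treats real and complex scalars at once.
\<close>

definition real_matrix_apply :: "real ^ 'n ^ 'm \<Rightarrow> 'a::real_vector ^ 'n \<Rightarrow> 'a ^ 'm" where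
  "real_matrix_apply A x = (\<chi> l. \<Sum>c\<in>UNIV. A $ l $ c *\<^sub>R x $ c)"

definition act_on_rows :: "real ^ 'n ^ 'm \<Rightarrow> 'a::real_vector ^ 'n ^ 'r \<Rightarrow> 'a ^ 'm ^ 'r" where
  "act_on_rows A X = (\<chi> r. real_matrix_apply A (X $ r))"

definition real_kron_sketch ::
    "real ^ 'p ^ 'k \<Rightarrow> real ^ 'q ^ 'k \<Rightarrow> real ^ ('k \<times> 'k) ^ 'k \<Rightarrow>
     'a::real_vector ^ 'p ^ 'q \<Rightarrow> 'a ^ 'k" where
  "real_kron_sketch S W G X =
     real_matrix_apply G (vec_cols (transpose (act_on_rows W (transpose (act_on_rows S X)))))"

lemma power2_norm_vec: "(norm (x :: 'a::real_normed_vector ^ 'n))\<^sup>2 = (\<Sum>i\<in>UNIV. (norm (x $ i))\<^sup>2)"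
  by (simp add: norm_vec_def L2_set_def sum_nonneg)

lemma norm_transpose: "norm (transpose (X :: 'a::real_normed_vector ^ 'n ^ 'm)) = norm X"
proof -
  have "(norm (transpose X))\<^sup>2 = (norm X)\<^sup>2"
    unfolding power2_norm_vec transpose_def vec_lambda_beta by (rule sum.swap)
  then show ?thesis by simp
qed

lemma norm_vec_cols: "norm (vec_cols (X :: 'a::real_normed_vector ^ 'n ^ 'm)) = norm X"
proof -
  have "(norm (vec_cols X))\<^sup>2 = (\<Sum>c\<in>UNIV \<times> UNIV. (norm (X $ snd c $ fst c))\<^sup>2)"
    by (simp add: power2_norm_vec vec_cols_def)
  also have "\<dots> = (\<Sum>j\<in>UNIV. \<Sum>i\<in>UNIV. (norm (X $ i $ j))\<^sup>2)"
    by (simp only: sum.cartesian_product' fst_conv snd_conv)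
  also have "\<dots> = (norm X)\<^sup>2"
    unfolding power2_norm_vec by (rule sum.swap)
  finally show ?thesis by simp
qed

lemma power2_norm_coordinates:
  "(norm (x :: 'a::euclidean_space ^ 'n))\<^sup>2 = (\<Sum>e\<in>Basis. (norm (\<chi> c. x $ c \<bullet> e))\<^sup>2)"
proof -
  have "(norm v)\<^sup>2 = (\<Sum>e\<in>Basis. (v \<bullet> e)\<^sup>2)" for v :: 'a
    by (subst power2_norm_eq_inner, subst euclidean_inner) (simp add: power2_eq_square)
  then show ?thesis
    unfolding power2_norm_vec by (subst sum.swap) simp
qed

text \<open>
  A real matrix acts on each real coordinate of the entries separately. This is how vectors with complex
  entries are reduced to families of real vectors.
\<close>

lemma power2_norm_real_matrix_apply:
  fixes x :: "'a::euclidean_space ^ 'n"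
  shows "(norm (real_matrix_apply A x))\<^sup>2 = (\<Sum>e\<in>Basis. (norm (A *v (\<chi> c. x $ c \<bullet> e)))\<^sup>2)"
  unfolding power2_norm_coordinates[of "real_matrix_apply A x"]
  by (intro sum.cong refl arg_cong[where f = "\<lambda>v. (norm v)\<^sup>2"])
    (simp add: vec_eq_iff real_matrix_apply_def matrix_vector_mult_def inner_sum_left)

lemma linear_real_matrix_apply: "linear (real_matrix_apply A)"
  by (rule linearI)
    (simp_all add: real_matrix_apply_def vec_eq_iff scaleR_right_distrib sum.distrib
      scaleR_sum_right mult.commute)

lemma linear_act_on_rows: "linear (act_on_rows A)"
  by (rule linearI)
    (simp_all add: act_on_rows_def vec_eq_iff linear_add[OF linear_real_matrix_apply]
      linear_cmul[OF linear_real_matrix_apply])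

lemma linear_transpose: "linear (transpose :: 'a::real_vector ^ 'n ^ 'm \<Rightarrow> _)"
  by (rule linearI) (simp_all add: transpose_def vec_eq_iff)

lemma linear_vec_cols: "linear (vec_cols :: 'a::real_vector ^ 'n ^ 'm \<Rightarrow> _)"
  by (rule linearI) (simp_all add: vec_cols_def vec_eq_iff)

lemma linear_real_kron_sketch: "linear (real_kron_sketch S W G)"
  by (rule linearI)
    (simp_all add: real_kron_sketch_def
      linear_add[OF linear_real_matrix_apply] linear_cmul[OF linear_real_matrix_apply]
      linear_add[OF linear_act_on_rows] linear_cmul[OF linear_act_on_rows]
      linear_add[OF linear_transpose] linear_cmul[OF linear_transpose]
      linear_add[OF linear_vec_cols] linear_cmul[OF linear_vec_cols])

lemma continuous_on_real_matrix_apply [continuous_intros]: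
  fixes f :: "'z::topological_space \<Rightarrow> real ^ 'n ^ 'm" and g :: "'z \<Rightarrow> 'a::real_normed_vector ^ 'n"
  assumes "continuous_on U f" "continuous_on U g"
  shows "continuous_on U (\<lambda>z. real_matrix_apply (f z) (g z))"
  unfolding real_matrix_apply_def by (intro continuous_intros assms)

lemma continuous_on_act_on_rows [continuous_intros]:
  fixes f :: "'z::topological_space \<Rightarrow> real ^ 'n ^ 'm" and g :: "'z \<Rightarrow> 'a::real_normed_vector ^ 'n ^ 'r"
  assumes "continuous_on U f" "continuous_on U g"
  shows "continuous_on U (\<lambda>z. act_on_rows (f z) (g z))"
  unfolding act_on_rows_def by (intro continuous_intros assms)

lemma continuous_on_transpose_vec [continuous_intros]:
  fixes f :: "'z::topological_space \<Rightarrow> 'a::real_normed_vector ^ 'n ^ 'm"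
  assumes "continuous_on U f"
  shows "continuous_on U (\<lambda>z. transpose (f z))"
  unfolding transpose_def by (intro continuous_intros assms)

lemma continuous_on_vec_cols [continuous_intros]:
  fixes f :: "'z::topological_space \<Rightarrow> 'a::real_normed_vector ^ 'n ^ 'm"
  assumes "continuous_on U f"
  shows "continuous_on U (\<lambda>z. vec_cols (f z))"
  unfolding vec_cols_def by (intro continuous_intros assms)

context prob_space
begin

lemma real_matrix_apply_concentration:
  fixes A :: "'a \<Rightarrow> real ^ 'n ^ 'k" and x :: "'i \<Rightarrow> 'b::euclidean_space ^ 'n"
  assumes A: "rescaled_gaussian A" and I: "finite I" and e: "0 < e" "e \<le> 1"
  defines "S \<equiv> \<Sum>i\<in>I. (norm (x i))\<^sup>2"
  shows "prob {\<omega> \<in> space M. \<bar>(\<Sum>i\<in>I. (norm (real_matrix_apply (A \<omega>) (x i)))\<^sup>2) - S\<bar> > e * S}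
    \<le> 2 * exp (- real CARD('k) * e\<^sup>2 / 8)"
proof -
  define y where "y = (\<lambda>(i, b). \<chi> c. x i $ c \<bullet> b)"
  have "(norm (x i))\<^sup>2 = (\<Sum>b\<in>Basis. (norm (y (i, b)))\<^sup>2)" for i
    using power2_norm_coordinates[of "x i"] by (simp add: y_def)
  then have "S = (\<Sum>i\<in>I \<times> Basis. (norm (y i))\<^sup>2)"
    by (simp only: S_def sum.cartesian_product')
  moreover have "(\<Sum>i\<in>I. (norm (real_matrix_apply (A \<omega>) (x i)))\<^sup>2)
      = (\<Sum>i\<in>I \<times> Basis. (norm (A \<omega> *v y i))\<^sup>2)" for \<omega>
    unfolding sum.cartesian_product' by (simp add: power2_norm_real_matrix_apply y_def)
  ultimately show ?thesis
    using rescaled_gaussian_concentration[OF A _ e, of "I \<times> Basis" y] I by simp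
qed

lemma act_on_rows_concentration:
  fixes A :: "'a \<Rightarrow> real ^ 'n ^ 'k" and X :: "'b::euclidean_space ^ 'n ^ 'r"
  assumes "rescaled_gaussian A" and "0 < e" "e \<le> 1"
  shows "prob {\<omega> \<in> space M. \<bar>(norm (act_on_rows (A \<omega>) X))\<^sup>2 - (norm X)\<^sup>2\<bar> > e * (norm X)\<^sup>2}
    \<le> 2 * exp (- real CARD('k) * e\<^sup>2 / 8)"
  using real_matrix_apply_concentration[OF assms(1) _ assms(2,3), where I = UNIV and x = "\<lambda>r. X $ r"]
  by (simp add: power2_norm_vec[of X] power2_norm_vec[of "act_on_rows (A _) X"]) (simp add: act_on_rows_def)

abbreviation preimages :: "('a \<Rightarrow> 'x::topological_space) \<Rightarrow> 'a set set" where
  "preimages X \<equiv> {X -` A \<inter> space M |A. A \<in> sets borel}"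

lemma Int_stable_preimages: "Int_stable (preimages X)"
proof (rule Int_stableI, safe)
  fix A B :: "'b set" assume "A \<in> sets borel" "B \<in> sets borel"
  then show "\<exists>C. X -` A \<inter> space M \<inter> (X -` B \<inter> space M) = X -` C \<inter> space M \<and> C \<in> sets borel"
    by (intro exI[of _ "A \<inter> B"]) auto
qed

lemma indep_set_mono: "indep_set A B \<Longrightarrow> A' \<subseteq> A \<Longrightarrow> B' \<subseteq> B \<Longrightarrow> indep_set A' B'"
  unfolding indep_sets2_eq by blast

text \<open>
  The three variables have values in different types, so the independence of two of them, or of a pair and
  the third, is stated for the families of their preimages of Borel sets.
\<close>

lemma indep_three_imp_indep_set:
  fixes X :: "'a \<Rightarrow> 'x::second_countable_topology" and Y :: "'a \<Rightarrow> 'y::second_countable_topology"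
    and Z :: "'a \<Rightarrow> 'z::second_countable_topology"
  assumes "indep_three X Y Z"
  shows "indep_set (preimages X) (preimages Y)"
    and "indep_set (preimages (\<lambda>\<omega>. (X \<omega>, Y \<omega>))) (preimages Z)"
proof -
  define E where "E = (\<lambda>i. [preimages X, preimages Y, preimages Z] ! i)"
  have rv [measurable]: "random_variable borel X" "random_variable borel Y" "random_variable borel Z"
    and ind: "indep_sets E {0, 1, 2}"
    using assms unfolding indep_three_def E_def by blast+
  have E: "E 0 = preimages X" "E 1 = preimages Y" "E 2 = preimages Z"
    by (simp_all add: E_def)
  have stableE: "Int_stable (E i)" if "i \<in> {0, 1, 2}" for i
    using that E Int_stable_preimages[of X] Int_stable_preimages[of Y] Int_stable_preimages[of Z]
    by (elim insertE emptyE) simp_all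
  have groups: "indep_set (sigma_sets (space M) (\<Union>i\<in>I. E i)) (sigma_sets (space M) (\<Union>i\<in>J. E i))"
    if IJ: "I \<union> J \<subseteq> {0, 1, 2}" "I \<inter> J = {}" for I J
  proof -
    have "indep_sets (\<lambda>j. sigma_sets (space M) (\<Union>i\<in>case_bool I J j. E i)) UNIV"
    proof (rule indep_sets_collect_sigma)
      show "indep_sets E (\<Union>j. case_bool I J j)"
        using IJ by (intro indep_sets_mono_index[OF _ ind]) (auto split: bool.splits)
      show "Int_stable (E i)" if "i \<in> case_bool I J j" for i j
        using that IJ by (intro stableE) (auto split: bool.splits)
      show "disjoint_family_on (case_bool I J) UNIV"
        using IJ by (auto simp: disjoint_family_on_def split: bool.splits)
    qed
    moreover have "(\<lambda>j. sigma_sets (space M) (\<Union>i\<in>case_bool I J j. E i)) =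
        case_bool (sigma_sets (space M) (\<Union>i\<in>I. E i)) (sigma_sets (space M) (\<Union>i\<in>J. E i))"
      by (auto split: bool.splits)
    ultimately show ?thesis by (simp add: indep_set_def)
  qed
  have gen: "E i \<subseteq> sigma_sets (space M) (\<Union>i\<in>I. E i)" if "i \<in> I" for i I
    using that by (auto intro: sigma_sets.Basic)
  show "indep_set (preimages X) (preimages Y)"
    using gen[of 0 "{0}"] gen[of 1 "{1}"] unfolding E
    by (intro indep_set_mono[OF groups[of "{0}" "{1}"]]) simp_all
  let ?N = "sigma (space M) (E 0 \<union> E 1)"
  have sub: "E 0 \<union> E 1 \<subseteq> Pow (space M)" unfolding E by blast
  have "X -` A \<inter> space M \<in> E 0" if "A \<in> sets borel" for A using that unfolding E by blast
  moreover have "Y -` A \<inter> space M \<in> E 1" if "A \<in> sets borel" for A using that unfolding E by blast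
  ultimately have "X \<in> measurable ?N borel" "Y \<in> measurable ?N borel"
    using sub by (intro measurableI; simp)+
  then have XY: "(\<lambda>\<omega>. (X \<omega>, Y \<omega>)) \<in> measurable ?N borel"
    by (subst borel_prod[symmetric]) (rule measurable_Pair)
  have "preimages (\<lambda>\<omega>. (X \<omega>, Y \<omega>)) \<subseteq> sigma_sets (space M) (E 0 \<union> E 1)"
  proof safe
    fix A :: "('x \<times> 'y) set" assume "A \<in> sets borel"
    from measurable_sets[OF XY this] sub
    show "(\<lambda>\<omega>. (X \<omega>, Y \<omega>)) -` A \<inter> space M \<in> sigma_sets (space M) (E 0 \<union> E 1)"
      by simp
  qed
  then show "indep_set (preimages (\<lambda>\<omega>. (X \<omega>, Y \<omega>))) (preimages Z)"
    using gen[of 2 "{2}"] unfolding E(3)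
    by (intro indep_set_mono[OF groups[of "{0, 1}" "{2}"]]) simp_all
qed

text \<open>
  If an event on \<open>(X, Y)\<close> is unlikely for every fixed value of \<open>X\<close>, it is unlikely: by independence
  the joint law is the product of the marginals, and Fubini's theorem applies. The open set \<open>R\<close> is a Borel
  set of the product because both spaces are second countable.
\<close>

lemma indep_set_prob_le:
  fixes X :: "'a \<Rightarrow> 'x::second_countable_topology" and Y :: "'a \<Rightarrow> 'y::second_countable_topology"
  assumes ind: "indep_set (preimages X) (preimages Y)"
    and [measurable]: "random_variable borel X" "random_variable borel Y" and R: "open R"
    and le: "\<And>x. prob {\<omega> \<in> space M. (x, Y \<omega>) \<in> R} \<le> c"
  shows "prob {\<omega> \<in> space M. (X \<omega>, Y \<omega>) \<in> R} \<le> c"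
proof -
  interpret X: prob_space "distr M borel X" by (rule prob_space_distr) measurable
  interpret Y: prob_space "distr M borel Y" by (rule prob_space_distr) measurable
  have distr: "distr M borel X \<Otimes>\<^sub>M distr M borel Y = distr M (borel \<Otimes>\<^sub>M borel) (\<lambda>\<omega>. (X \<omega>, Y \<omega>))"
  proof (rule pair_measure_eqI)
    fix A B assume "A \<in> sets (distr M borel X)" "B \<in> sets (distr M borel Y)"
    then have AB [measurable]: "A \<in> sets borel" "B \<in> sets borel" by auto
    then have "prob (X -` A \<inter> space M \<inter> (Y -` B \<inter> space M))
        = prob (X -` A \<inter> space M) * prob (Y -` B \<inter> space M)"
      by (intro indep_setD[OF ind]) blast+
    moreover have "(\<lambda>\<omega>. (X \<omega>, Y \<omega>)) -` (A \<times> B) \<inter> space M = X -` A \<inter> space M \<inter> (Y -` B \<inter> space M)"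
      by auto
    ultimately show "emeasure (distr M borel X) A * emeasure (distr M borel Y) B
        = emeasure (distr M (borel \<Otimes>\<^sub>M borel) (\<lambda>\<omega>. (X \<omega>, Y \<omega>))) (A \<times> B)"
      by (simp add: emeasure_distr emeasure_eq_measure ennreal_mult)
  qed (simp_all add: X.sigma_finite_measure_axioms Y.sigma_finite_measure_axioms
      cong: sets_pair_measure_cong)
  have R' [measurable]: "R \<in> sets (borel \<Otimes>\<^sub>M borel)" unfolding borel_prod using R by simp
  have c: "c \<ge> 0" by (rule order_trans[OF measure_nonneg le])
  have "emeasure M {\<omega> \<in> space M. (X \<omega>, Y \<omega>) \<in> R}
      = emeasure (distr M borel X \<Otimes>\<^sub>M distr M borel Y) R"
    unfolding distr by (subst emeasure_distr) (auto intro!: arg_cong[where f = "emeasure M"])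
  also have "\<dots> = (\<integral>\<^sup>+x. emeasure (distr M borel Y) (Pair x -` R) \<partial>distr M borel X)"
    by (rule Y.emeasure_pair_measure_alt) simp
  also have "\<dots> \<le> (\<integral>\<^sup>+x. ennreal c \<partial>distr M borel X)"
  proof (rule nn_integral_mono)
    fix x
    have "Pair x -` R \<in> sets borel" using sets_Pair1[OF R'] by simp
    then have "emeasure (distr M borel Y) (Pair x -` R) = emeasure M {\<omega> \<in> space M. (x, Y \<omega>) \<in> R}"
      by (subst emeasure_distr) (auto intro!: arg_cong[where f = "emeasure M"])
    also have "\<dots> \<le> ennreal c" unfolding emeasure_eq_measure by (rule ennreal_leI[OF le])
    finally show "emeasure (distr M borel Y) (Pair x -` R) \<le> ennreal c" .
  qed
  also have "\<dots> = ennreal c" using X.emeasure_space_1 by simp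
  finally show ?thesis using c by (simp add: emeasure_eq_measure)
qed

text \<open>
  The three stages produce \<open>Y\<close>, \<open>Z\<close> and \<open>K\<close>; \<open>R1\<close>, \<open>R2\<close> and \<open>R3\<close>
  say that a stage distorts its input by a relative error of more than \<open>e / 4\<close>. Outside of them the
  errors multiply.
\<close>

lemma real_kron_sketch_concentration:
  fixes S :: "'a \<Rightarrow> real ^ 'p ^ 'k" and W :: "'a \<Rightarrow> real ^ 'q ^ 'k"
    and G :: "'a \<Rightarrow> real ^ ('k \<times> 'k) ^ 'k" and X :: "'b::euclidean_space ^ 'p ^ 'q"
  assumes gauss: "rescaled_gaussian S" "rescaled_gaussian W" "rescaled_gaussian G"
    and ind: "indep_three S W G" and e: "0 < e" "e \<le> 1"
  defines "K \<equiv> \<lambda>\<omega>. real_kron_sketch (S \<omega>) (W \<omega>) (G \<omega>) X"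
  shows "prob {\<omega> \<in> space M. \<bar>(norm (K \<omega>))\<^sup>2 - (norm X)\<^sup>2\<bar> > 61 / 64 * e * (norm X)\<^sup>2}
    \<le> 6 * exp (- real CARD('k) * e\<^sup>2 / 128)"
proof -
  let ?t = "e / 4" and ?c = "2 * exp (- real CARD('k) * (e / 4)\<^sup>2 / 8)"
  have t: "0 < ?t" "?t \<le> 1" using e by auto
  have up3: "(1 + r) * ((1 + r) * ((1 + r) * a)) = a + (3 * r + 3 * (r * r) + r * (r * r)) * a"
    and down3: "(1 - r) * ((1 - r) * ((1 - r) * a)) = a - (3 * r - 3 * (r * r) + r * (r * r)) * a"
    for r a :: real
    by (simp_all add: algebra_simps)
  have [measurable]: "random_variable borel S" "random_variable borel W" "random_variable borel G"
    using ind by (auto simp: indep_three_def)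
  have SW [measurable]: "random_variable borel (\<lambda>\<omega>. (S \<omega>, W \<omega>))"
    by (subst borel_prod[symmetric]) measurable
  have SWG: "random_variable borel (\<lambda>\<omega>. ((S \<omega>, W \<omega>), G \<omega>))"
    by (subst borel_prod[symmetric]) measurable
  define Y where "Y s = transpose (act_on_rows s X)" for s :: "real ^ 'p ^ 'k"
  define Z where "Z s w = vec_cols (transpose (act_on_rows w (Y s)))"
    for s :: "real ^ 'p ^ 'k" and w :: "real ^ 'q ^ 'k"
  have K: "K \<omega> = real_matrix_apply (G \<omega>) (Z (S \<omega>) (W \<omega>))" for \<omega>
    by (simp add: K_def Z_def Y_def real_kron_sketch_def)
  have normY: "norm (Y s) = norm (act_on_rows s X)" for s by (simp add: Y_def norm_transpose)
  have normZ: "norm (Z s w) = norm (act_on_rows w (Y s))" for s w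
    by (simp add: Z_def norm_transpose norm_vec_cols)
  define R1 where "R1 = {s. ?t * (norm X)\<^sup>2 < \<bar>(norm (Y s))\<^sup>2 - (norm X)\<^sup>2\<bar>}"
  define R2 where "R2 = {p. ?t * (norm (Y (fst p)))\<^sup>2
      < \<bar>(norm (Z (fst p) (snd p)))\<^sup>2 - (norm (Y (fst p)))\<^sup>2\<bar>}"
  define R3 where "R3 = {p :: ((real ^ 'p ^ 'k) \<times> (real ^ 'q ^ 'k)) \<times> (real ^ ('k \<times> 'k) ^ 'k).
      ?t * (norm (Z (fst (fst p)) (snd (fst p))))\<^sup>2
      < \<bar>(norm (real_matrix_apply (snd p) (Z (fst (fst p)) (snd (fst p)))))\<^sup>2
          - (norm (Z (fst (fst p)) (snd (fst p))))\<^sup>2\<bar>}"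
  have opens: "open R1" "open R2" "open R3"
    unfolding R1_def R2_def R3_def Z_def Y_def by (intro open_Collect_less continuous_intros)+
  have E1: "prob {\<omega> \<in> space M. S \<omega> \<in> R1} \<le> ?c"
    using act_on_rows_concentration[OF gauss(1) t, of X] by (simp add: R1_def normY)
  have E2: "prob {\<omega> \<in> space M. (S \<omega>, W \<omega>) \<in> R2} \<le> ?c"
  proof (rule indep_set_prob_le[OF indep_three_imp_indep_set(1)[OF ind] _ _ opens(2)])
    show "prob {\<omega> \<in> space M. (s, W \<omega>) \<in> R2} \<le> ?c" for s
      using act_on_rows_concentration[OF gauss(2) t, of "Y s"] by (simp add: R2_def normZ)
  qed measurable
  have E3: "prob {\<omega> \<in> space M. ((S \<omega>, W \<omega>), G \<omega>) \<in> R3} \<le> ?c"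
  proof (rule indep_set_prob_le[OF indep_three_imp_indep_set(2)[OF ind] _ _ opens(3)])
    show "prob {\<omega> \<in> space M. (sw, G \<omega>) \<in> R3} \<le> ?c" for sw
      using real_matrix_apply_concentration[OF gauss(3) _ t, of "{()}" "\<lambda>_. Z (fst sw) (snd sw)"]
      by (simp add: R3_def)
  qed measurable
  let ?E1 = "{\<omega> \<in> space M. S \<omega> \<in> R1}" and ?E2 = "{\<omega> \<in> space M. (S \<omega>, W \<omega>) \<in> R2}"
    and ?E3 = "{\<omega> \<in> space M. ((S \<omega>, W \<omega>), G \<omega>) \<in> R3}"
  have sets: "?E1 \<in> events" "?E2 \<in> events" "?E3 \<in> events"
    using measurable_sets[of S M borel R1] measurable_sets[OF SW, of R2]
      measurable_sets[OF SWG, of R3] opens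
    by (simp_all add: vimage_def Int_def conj_commute)
  have "{\<omega> \<in> space M. \<bar>(norm (K \<omega>))\<^sup>2 - (norm X)\<^sup>2\<bar> > 61 / 64 * e * (norm X)\<^sup>2} \<subseteq> ?E1 \<union> ?E2 \<union> ?E3"
  proof (rule subsetI, rule ccontr)
    fix \<omega>
    assume \<omega>: "\<omega> \<in> {\<omega> \<in> space M. \<bar>(norm (K \<omega>))\<^sup>2 - (norm X)\<^sup>2\<bar> > 61 / 64 * e * (norm X)\<^sup>2}"
      and good: "\<omega> \<notin> ?E1 \<union> ?E2 \<union> ?E3"
    define a0 a1 a2 a3 where a: "a0 = (norm X)\<^sup>2" "a1 = (norm (Y (S \<omega>)))\<^sup>2"
      "a2 = (norm (Z (S \<omega>) (W \<omega>)))\<^sup>2" "a3 = (norm (K \<omega>))\<^sup>2"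
    have dev: "\<bar>a1 - a0\<bar> \<le> ?t * a0" "\<bar>a2 - a1\<bar> \<le> ?t * a1" "\<bar>a3 - a2\<bar> \<le> ?t * a2"
      using good \<omega> by (auto simp: R1_def R2_def R3_def a K not_less)
    have a0: "a0 \<ge> 0" by (simp add: a)
    have "a3 \<le> (1 + ?t) * a2" "a2 \<le> (1 + ?t) * a1" "a1 \<le> (1 + ?t) * a0"
      using dev unfolding distrib_right mult_1_left by linarith+
    then have "a3 \<le> (1 + ?t) * ((1 + ?t) * ((1 + ?t) * a0))"
      using e by (meson add_nonneg_nonneg mult_left_mono order_trans t(1) less_imp_le zero_le_one)
    also have "\<dots> = a0 + (3 * ?t + 3 * (?t * ?t) + ?t * (?t * ?t)) * a0"
      by (rule up3)
    also have "\<dots> \<le> a0 + (61 / 64 * e) * a0"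
    proof -
      have "e * e \<le> e" using mult_left_mono[of e 1 e] e by simp
      moreover have "e * (e * e) \<le> e * e" using mult_left_mono[of e 1 "e * e"] e by simp
      ultimately show ?thesis using a0 by (intro add_left_mono mult_right_mono) auto
    qed
    finally have up: "a3 - a0 \<le> 61 / 64 * e * a0" by simp
    have "(1 - ?t) * a2 \<le> a3" "(1 - ?t) * a1 \<le> a2" "(1 - ?t) * a0 \<le> a1"
      using dev unfolding left_diff_distrib mult_1_left by linarith+
    moreover have "0 \<le> 1 - ?t" using e by simp
    ultimately have "(1 - ?t) * ((1 - ?t) * ((1 - ?t) * a0)) \<le> a3"
      by (meson mult_left_mono order_trans)
    moreover have "(1 - ?t) * ((1 - ?t) * ((1 - ?t) * a0))
        = a0 - (3 * ?t - 3 * (?t * ?t) + ?t * (?t * ?t)) * a0"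
      by (rule down3)
    moreover have "(3 * ?t - 3 * (?t * ?t) + ?t * (?t * ?t)) * a0 \<le> (61 / 64 * e) * a0"
    proof -
      have "e * (e * e) \<le> e * e" using mult_left_mono[of e 1 "e * e"] e by simp
      moreover have "0 \<le> e * e" by simp
      ultimately have "e * (e * e) - 12 * (e * e) \<le> 13 * e" using e by linarith
      then have "3 * ?t - 3 * (?t * ?t) + ?t * (?t * ?t) \<le> 61 / 64 * e" by simp
      then show ?thesis using a0 by (rule mult_right_mono)
    qed
    ultimately have "a0 - a3 \<le> 61 / 64 * e * a0" by linarith
    moreover have "\<bar>a3 - a0\<bar> > 61 / 64 * e * a0" using \<omega> unfolding a by blast
    ultimately show False using up by linarith
  qed
  then have "prob {\<omega> \<in> space M. \<bar>(norm (K \<omega>))\<^sup>2 - (norm X)\<^sup>2\<bar> > 61 / 64 * e * (norm X)\<^sup>2}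
      \<le> prob (?E1 \<union> ?E2 \<union> ?E3)"
    using sets by (intro finite_measure_mono) auto
  also have "\<dots> \<le> prob ?E1 + prob ?E2 + prob ?E3"
    using measure_Un_le[of "?E1 \<union> ?E2" M ?E3] measure_Un_le[of ?E1 M ?E2] sets by auto
  also have "\<dots> \<le> 3 * ?c" using E1 E2 E3 by linarith
  finally show ?thesis by (simp add: power_divide)
qed

text \<open>
  The net has at most \<open>(101 * exp 1) ^ n\<close> points, and \<open>101 \<le> 2.7 ^ 5 \<le> exp 5\<close>. The factor
  \<open>168 / 128 \<ge> 1\<close> absorbs the dimension term and leaves \<open>6 * exp (- ln (6 / \<delta>)) = \<delta>\<close>.
\<close>

lemma kron_sketch_union_bound:
  fixes e \<delta> k :: real
  assumes e: "0 < e" and \<delta>: "0 < \<delta>" "\<delta> < 1"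
    and k: "k \<ge> 168 / e\<^sup>2 * (6.9 * real m + ln (6 / \<delta>))" and nm: "n \<le> m"
  shows "(exp 1 * (1 + 2 / (1 / 50))) ^ n * (6 * exp (- k * e\<^sup>2 / 128)) \<le> \<delta>"
proof -
  have e1: "exp 1 \<ge> (27 / 10 :: real)" using e_approx_32 by (simp add: abs_if split: if_splits)
  have "exp 1 * 101 \<le> exp 1 * (exp (1 :: real)) ^ 5"
    using power_mono[OF e1, of 5] by (intro mult_left_mono) (auto simp: power_divide)
  also have "\<dots> = exp (6 :: real)" by (simp flip: exp_of_nat_mult exp_add)
  also have "\<dots> \<le> exp 6.9" by simp
  finally have "(exp 1 * (1 + 2 / (1 / 50))) ^ n \<le> exp (6.9 :: real) ^ n"
    by (intro power_mono) auto
  also have "\<dots> \<le> exp 6.9 ^ m" using nm by (intro power_increasing) auto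
  also have "\<dots> = exp (6.9 * real m)" by (simp add: mult.commute flip: exp_of_nat_mult)
  finally have N: "(exp 1 * (1 + 2 / (1 / 50))) ^ n \<le> exp (6.9 * real m)" .
  have L: "ln (6 / \<delta>) \<ge> 0" using \<delta> by (intro ln_ge_zero) (simp add: field_simps)
  have "k * e\<^sup>2 \<ge> 168 * (6.9 * real m + ln (6 / \<delta>))"
    using k e by (simp add: field_simps)
  then have "6.9 * real m - k * e\<^sup>2 / 128 \<le> - ln (6 / \<delta>)"
    using L by (simp add: field_simps)
  then have "exp (6.9 * real m - k * e\<^sup>2 / 128) \<le> exp (- ln (6 / \<delta>))" by simp
  also have "\<dots> = \<delta> / 6" using \<delta> by (simp add: exp_minus)
  finally have "6 * exp (6.9 * real m - k * e\<^sup>2 / 128) \<le> \<delta>" by simp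
  moreover have "exp (6.9 * real m) * (6 * exp (- k * e\<^sup>2 / 128))
      = 6 * exp (6.9 * real m + - k * e\<^sup>2 / 128)"
    by (simp only: exp_add mult.left_commute)
  ultimately have "exp (6.9 * real m) * (6 * exp (- k * e\<^sup>2 / 128)) \<le> \<delta>"
    by simp
  moreover have "(exp 1 * (1 + 2 / (1 / 50))) ^ n * (6 * exp (- k * e\<^sup>2 / 128))
      \<le> exp (6.9 * real m) * (6 * exp (- k * e\<^sup>2 / 128))"
    by (intro mult_right_mono N) simp
  ultimately show ?thesis by linarith
qed

text \<open>
  The event quantifies over an uncountable set, but it is an intersection of closed conditions on the three
  matrices, hence measurable.
\<close>

lemma real_kron_sketch_embedding:
  fixes S :: "'a \<Rightarrow> real ^ 'p ^ 'k" and W :: "'a \<Rightarrow> real ^ 'q ^ 'k"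
    and G :: "'a \<Rightarrow> real ^ ('k \<times> 'k) ^ 'k" and V :: "('b::euclidean_space ^ 'p ^ 'q) set"
  assumes gauss: "rescaled_gaussian S" "rescaled_gaussian W" "rescaled_gaussian G"
    and ind: "indep_three S W G" and e: "0 < e" "e < 1" and \<delta>: "0 < \<delta>" "\<delta> < 1"
    and V: "subspace V" "dim V \<le> m"
    and k: "real CARD('k) \<ge> 168 / e\<^sup>2 * (6.9 * real m + ln (6 / \<delta>))"
  defines "K \<equiv> \<lambda>\<omega>. real_kron_sketch (S \<omega>) (W \<omega>) (G \<omega>)"
  shows "prob {\<omega> \<in> space M. \<forall>x\<in>V. \<forall>y\<in>V. \<bar>x \<bullet> y - K \<omega> x \<bullet> K \<omega> y\<bar> \<le> e * norm x * norm y} \<ge> 1 - \<delta>"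
proof -
  have [measurable]: "random_variable borel S" "random_variable borel W" "random_variable borel G"
    using ind by (auto simp: indep_three_def)
  have SWG: "random_variable borel (\<lambda>\<omega>. (S \<omega>, W \<omega>, G \<omega>))"
    by (simp only: borel_prod[symmetric]) measurable
  have ev: "{\<omega> \<in> space M. (S \<omega>, W \<omega>, G \<omega>) \<in> A} \<in> events" if "A \<in> sets borel" for A
    using measurable_sets[OF SWG that] by (simp add: vimage_def Int_def conj_commute)
  let ?good = "{\<omega> \<in> space M. \<forall>x\<in>V. \<forall>y\<in>V. \<bar>x \<bullet> y - K \<omega> x \<bullet> K \<omega> y\<bar> \<le> e * norm x * norm y}"
  define C where "C = {p :: (real ^ 'p ^ 'k) \<times> (real ^ 'q ^ 'k) \<times> (real ^ ('k \<times> 'k) ^ 'k).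
      \<forall>x\<in>V. \<forall>y\<in>V. \<bar>x \<bullet> y - real_kron_sketch (fst p) (fst (snd p)) (snd (snd p)) x
      \<bullet> real_kron_sketch (fst p) (fst (snd p)) (snd (snd p)) y\<bar> \<le> e * norm x * norm y}"
  have "closed C"
    unfolding C_def Ball_def real_kron_sketch_def
    by (intro closed_Collect_all closed_Collect_imp closed_Collect_le continuous_intros open_Collect_const)
  moreover have "?good = {\<omega> \<in> space M. (S \<omega>, W \<omega>, G \<omega>) \<in> C}"
    unfolding C_def K_def by (simp only: mem_Collect_eq fst_conv snd_conv)
  ultimately have good: "?good \<in> events"
    using ev[OF borel_closed] by (simp only:)
  \<comment> \<open>The mesh must satisfy \<open>61 / 64 / (1 - 2 * g) \<le> 1\<close>; \<open>g = 1 / 50\<close> does.\<close>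
  have "(1 / 50 :: real) > 0" by simp
  from subspace_ball_net[OF V(1) this] obtain N where N: "finite N" "N \<subseteq> V" "\<And>u. u \<in> N \<Longrightarrow> norm u \<le> 1"
    "real (card N) \<le> (exp 1 * (1 + 2 / (1 / 50))) ^ dim V"
    "\<And>x. x \<in> V \<Longrightarrow> norm x \<le> 1 \<Longrightarrow> \<exists>u\<in>N. norm (x - u) \<le> 1 / 50"
    by blast
  define D where "D u = {p :: (real ^ 'p ^ 'k) \<times> (real ^ 'q ^ 'k) \<times> (real ^ ('k \<times> 'k) ^ 'k).
      61 / 64 * e * (norm u)\<^sup>2
      < \<bar>(norm (real_kron_sketch (fst p) (fst (snd p)) (snd (snd p)) u))\<^sup>2 - (norm u)\<^sup>2\<bar>}"
    for u :: "'b ^ 'p ^ 'q"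
  let ?bad = "\<lambda>u. {\<omega> \<in> space M. 61 / 64 * e * (norm u)\<^sup>2 < \<bar>(norm (K \<omega> u))\<^sup>2 - (norm u)\<^sup>2\<bar>}"
  have "open (D u)" for u
    unfolding D_def real_kron_sketch_def by (intro open_Collect_less continuous_intros)
  moreover have "?bad u = {\<omega> \<in> space M. (S \<omega>, W \<omega>, G \<omega>) \<in> D u}" for u
    unfolding D_def K_def by (simp only: mem_Collect_eq fst_conv snd_conv)
  ultimately have bad: "?bad u \<in> events" for u
    using ev[OF borel_open] by (simp only:)
  have "space M - ?good \<subseteq> (\<Union>u\<in>N. ?bad u)"
  proof (rule subsetI, rule ccontr)
    fix \<omega> assume \<omega>: "\<omega> \<in> space M - ?good" "\<omega> \<notin> (\<Union>u\<in>N. ?bad u)"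
    have "\<omega> \<in> space M" using \<omega>(1) by (rule DiffD1)
    have small: "\<bar>(norm (K \<omega> u))\<^sup>2 - (norm u)\<^sup>2\<bar> \<le> 61 / 64 * e" if u: "u \<in> N" for u
    proof -
      have "\<bar>(norm (K \<omega> u))\<^sup>2 - (norm u)\<^sup>2\<bar> \<le> 61 / 64 * e * (norm u)\<^sup>2"
      proof -
        have "\<omega> \<notin> ?bad u" using UN_I[OF u, of \<omega> ?bad] \<omega>(2) by (rule contrapos_nn[rotated])
        then show ?thesis using \<open>\<omega> \<in> space M\<close> by (simp only: mem_Collect_eq not_less simp_thms)
      qed
      also have "\<dots> \<le> 61 / 64 * e * 1"
        using e N(3)[OF u] by (intro mult_left_mono) (auto simp: power_le_one)
      finally show ?thesis by simp
    qed
    have net: "\<bar>x \<bullet> y - K \<omega> x \<bullet> K \<omega> y\<bar> \<le> 61 / 64 * e / (1 - 2 * (1 / 50)) * norm x * norm y"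
      if "x \<in> V" "y \<in> V" for x y
    proof (rule inner_defect_le_of_net[OF V(1) _ N(2) _ _ _ _ that])
      show "linear (K \<omega>)" unfolding K_def by (rule linear_real_kron_sketch)
      show "2 * (1 / 50 :: real) < 1" by simp
    qed (fact N(3), fact N(5), fact small)
    have "\<bar>x \<bullet> y - K \<omega> x \<bullet> K \<omega> y\<bar> \<le> e * norm x * norm y" if "x \<in> V" "y \<in> V" for x y
    proof -
      have "61 / 64 * e / (1 - 2 * (1 / 50)) * (norm x * norm y) \<le> e * (norm x * norm y)"
        using e by (intro mult_right_mono) auto
      then show ?thesis using net[OF that] by (simp add: mult.assoc)
    qed
    then have inside: "\<omega> \<in> ?good" using \<open>\<omega> \<in> space M\<close> by (intro CollectI conjI ballI)
    show False by (rule DiffD2[OF \<omega>(1) inside])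
  qed
  then have "prob (space M - ?good) \<le> prob (\<Union>u\<in>N. ?bad u)"
    by (rule finite_measure_mono) (intro sets.finite_UN N(1) bad)
  also have "\<dots> \<le> (\<Sum>u\<in>N. prob (?bad u))"
    by (intro measure_UNION_le N(1) bad)
  also have "\<dots> \<le> (\<Sum>u\<in>N. 6 * exp (- real CARD('k) * e\<^sup>2 / 128))"
    unfolding K_def by (intro sum_mono real_kron_sketch_concentration gauss ind) (use e in auto)
  also have "\<dots> = real (card N) * (6 * exp (- real CARD('k) * e\<^sup>2 / 128))" by simp
  also have "\<dots> \<le> (exp 1 * (1 + 2 / (1 / 50))) ^ dim V * (6 * exp (- real CARD('k) * e\<^sup>2 / 128))"
    by (intro mult_right_mono N(4)) simp
  also have "\<dots> \<le> \<delta>"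
    by (rule kron_sketch_union_bound[OF e(1) \<delta> k V(2)])
  finally show ?thesis unfolding prob_compl[OF good] by linarith
qed

end

section \<open>Real and complex scalars\<close>

text \<open>
  The matrices \<open>S\<close>, \<open>W\<close>, \<open>G\<close> are real, so conjugation leaves their entries alone and
  multiplication by an entry is a real scaling.
\<close>

lemma kron_sketch_eq_real:
  fixes X :: "'a::{conjugatable_field, real_normed_field} ^ 'p ^ 'q"
  assumes conj: "\<And>r. conjugate (of_real r :: 'a) = of_real r"
  shows "kron_sketch S W G X = real_kron_sketch S W G X"
proof -
  have "(map_matrix of_real W ** X ** conj_transpose (map_matrix of_real S)) $ i $ j
      = transpose (act_on_rows W (transpose (act_on_rows S X))) $ i $ j" for i j
  proof -
    have "(\<Sum>a\<in>UNIV. (\<Sum>b\<in>UNIV. of_real (W $ i $ b) * X $ b $ a) * of_real (S $ j $ a))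
        = (\<Sum>a\<in>UNIV. \<Sum>b\<in>UNIV. W $ i $ b *\<^sub>R (S $ j $ a *\<^sub>R X $ b $ a))"
      unfolding sum_distrib_right scaleR_conv_of_real
      by (intro sum.cong refl) (simp add: mult_ac)
    also have "\<dots> = (\<Sum>b\<in>UNIV. W $ i $ b *\<^sub>R (\<Sum>a\<in>UNIV. S $ j $ a *\<^sub>R X $ b $ a))"
      by (subst sum.swap) (simp add: scaleR_sum_right)
    finally show ?thesis
      by (simp add: matrix_matrix_mult_def conj_transpose_def map_matrix_def transpose_def
          act_on_rows_def real_matrix_apply_def conj)
  qed
  then have entries: "map_matrix of_real W ** X ** conj_transpose (map_matrix of_real S)
      = transpose (act_on_rows W (transpose (act_on_rows S X)))"
    by (simp add: vec_eq_iff)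
  show ?thesis
    unfolding kron_sketch_def real_kron_sketch_def entries
    by (simp add: real_matrix_apply_def vec_eq_iff matrix_vector_mult_def map_matrix_def
        scaleR_conv_of_real)
qed

lemma kron_sketch_mat_scale:
  fixes X :: "'a::{conjugatable_field, real_normed_field} ^ 'p ^ 'q"
  shows "kron_sketch S W G (mat_scale c X) = c *s kron_sketch S W G X"
  by (simp add: kron_sketch_def mat_scale_def map_matrix_def matrix_vector_mult_def vec_cols_def
      matrix_matrix_mult_def vec_eq_iff sum_distrib_left mult_ac)

lemma vector_space_mat_scale: "vector_space (mat_scale :: 'a::field \<Rightarrow> 'a ^ 'p ^ 'q \<Rightarrow> _)"
  by standard (simp_all add: mat_scale_def map_matrix_def vec_eq_iff algebra_simps)

lemma frobenius_inner_sum: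
  "frobenius_inner X Y = (\<Sum>a\<in>UNIV. \<Sum>b\<in>UNIV. conjugate (X $ b $ a) * Y $ b $ a)"
  by (simp add: frobenius_inner_def trace_def matrix_matrix_mult_def conj_transpose_def
      map_matrix_def transpose_def)

lemma frobenius_inner_real: "frobenius_inner X Y = X \<bullet> (Y :: real ^ 'p ^ 'q)"
  unfolding frobenius_inner_sum inner_vec_def by (subst sum.swap) (simp add: conjugate_real_def)

lemma induced_norm_frobenius_real: "induced_norm frobenius_inner X = norm (X :: real ^ 'p ^ 'q)"
  by (simp add: induced_norm_def frobenius_inner_real norm_eq_sqrt_inner[of X])

lemma canonical_inner_real: "canonical_inner x y = x \<bullet> (y :: real ^ 'n)"
  by (simp add: canonical_inner_def inner_vec_def conjugate_real_def)

lemma Re_frobenius_inner: "Re (frobenius_inner X Y) = X \<bullet> (Y :: complex ^ 'p ^ 'q)"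
  unfolding frobenius_inner_sum inner_vec_def
  by (subst sum.swap) (simp add: conjugate_complex_def inner_complex_def)

lemma Re_canonical_inner: "Re (canonical_inner x y) = x \<bullet> (y :: complex ^ 'n)"
  by (simp add: canonical_inner_def inner_vec_def conjugate_complex_def inner_complex_def)

lemma induced_norm_frobenius_complex:
  "induced_norm frobenius_inner X = norm (X :: complex ^ 'p ^ 'q)"
proof -
  have "Im (frobenius_inner X X) = 0"
    by (simp add: frobenius_inner_sum conjugate_complex_def)
  then have "frobenius_inner X X = of_real (X \<bullet> X)"
    by (simp add: complex_eq_iff Re_frobenius_inner)
  then show ?thesis
    by (simp add: induced_norm_def norm_eq_sqrt_inner[of X])
qed

lemma frobenius_inner_mat_scale_right: "frobenius_inner X (mat_scale c Y) = c * frobenius_inner X Y"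
  by (simp add: frobenius_inner_sum mat_scale_def map_matrix_def sum_distrib_left mult_ac)

lemma canonical_inner_scale_right: "canonical_inner x (c *s y) = c * canonical_inner x y"
  by (simp add: canonical_inner_def sum_distrib_left mult_ac)

lemma norm_mat_scale: "norm (mat_scale c X) = norm c * norm (X :: complex ^ 'p ^ 'q)"
proof -
  have "(norm (mat_scale c X))\<^sup>2 = (norm c * norm X)\<^sup>2"
    by (simp add: power2_norm_vec mat_scale_def map_matrix_def norm_mult power_mult_distrib sum_distrib_left)
  then show ?thesis by simp
qed

text \<open>
  If \<open>B\<close> spans \<open>V\<close> over the complex numbers, then \<open>B\<close> and its multiples by \<open>\<i>\<close> span
  it over the reals. A dimension of at least \<open>1\<close> guarantees that a basis of that cardinality is finite.
\<close>

lemma complex_subspace_imp_real_subspace: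
  fixes V :: "(complex ^ 'p ^ 'q) set"
  assumes V: "module.subspace mat_scale V" and d: "vector_space.dim mat_scale V = d" "d \<ge> 1"
  shows "subspace V" "dim V \<le> 2 * d"
proof -
  interpret cvs: vector_space "mat_scale :: complex \<Rightarrow> complex ^ 'p ^ 'q \<Rightarrow> _"
    by (rule vector_space_mat_scale)
  have scaleR: "r *\<^sub>R X = mat_scale (of_real r) X" for r and X :: "complex ^ 'p ^ 'q"
    by (simp add: mat_scale_def map_matrix_def vec_eq_iff scaleR_conv_of_real[where 'a = complex])
  show "subspace V"
    unfolding subspace_def using cvs.subspace_0[OF V] cvs.subspace_add[OF V] cvs.subspace_scale[OF V]
    by (simp add: scaleR)
  obtain B where B: "B \<subseteq> V" "V \<subseteq> cvs.span B" "card B = d"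
    using cvs.basis_exists[of V] d(1) by metis
  have fin: "finite B" using B(3) d(2) by (metis card.infinite not_one_le_zero)
  let ?C = "B \<union> mat_scale \<i> ` B"
  have i_closed: "mat_scale \<i> x \<in> span ?C" if "x \<in> span ?C" for x
    using that
  proof (induction rule: span_induct_alt)
    case base
    then show ?case using cvs.scale_zero_right[of \<i>] by (simp add: span_zero)
  next
    case (step c x y)
    have "mat_scale \<i> x \<in> span ?C"
    proof (cases "x \<in> B")
      case True
      then show ?thesis by (intro span_base) auto
    next
      case False
      then obtain b where b: "b \<in> B" "x = mat_scale \<i> b" using step by auto
      then have "mat_scale \<i> x = - b" by simp
      then show ?thesis using b by (auto intro: span_neg span_base)
    qed
    moreover have "mat_scale \<i> (c *\<^sub>R x + y) = c *\<^sub>R mat_scale \<i> x + mat_scale \<i> y"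
      by (simp add: scaleR cvs.scale_right_distrib mult.commute)
    ultimately show ?case using step by (simp add: span_add span_scale)
  qed
  have "x \<in> span ?C" if "x \<in> cvs.span B" for x
    using that
  proof (induction rule: cvs.span_induct_alt)
    case base
    then show ?case by (rule span_zero)
  next
    case (step c x y)
    have x: "x \<in> span ?C" using step by (intro span_base) auto
    have "mat_scale c x = Re c *\<^sub>R x + Im c *\<^sub>R mat_scale \<i> x"
      unfolding scaleR cvs.scale_scale cvs.scale_left_distrib[symmetric]
      by (metis complex_eq mult.commute)
    then have "mat_scale c x \<in> span ?C"
      using x i_closed[OF x] by (simp add: span_add span_scale)
    then show ?case using step by (intro span_add) auto
  qed
  then have "V \<subseteq> span ?C" using B(2) by blast
  then have "dim V \<le> card ?C" using fin by (intro dim_le_card) auto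
  also have "\<dots> \<le> card B + card (mat_scale \<i> ` B)" by (rule card_Un_le)
  also have "\<dots> \<le> 2 * d" using card_image_le[OF fin, of "mat_scale \<i>"] B(3) by simp
  finally show "dim V \<le> 2 * d" .
qed

lemma linear_kron_sketch:
  fixes S :: "real ^ 'p ^ 'k"
  assumes "\<And>r. conjugate (of_real r :: 'a::{conjugatable_field, real_normed_field}) = of_real r"
  shows "Vector_Spaces.linear mat_scale (*s) (kron_sketch S W G :: 'a ^ 'p ^ 'q \<Rightarrow> 'a ^ 'k)"
proof -
  have "kron_sketch S W G (X + Y) = kron_sketch S W G X + kron_sketch S W G Y" for X Y :: "'a ^ 'p ^ 'q"
    using assms by (simp add: kron_sketch_eq_real linear_add[OF linear_real_kron_sketch])
  then show ?thesis
    unfolding Vector_Spaces.linear_iff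
    using vector_space_mat_scale vec.vector_space_axioms kron_sketch_mat_scale by blast
qed

lemma (in prob_space) kron_sketch_measurable:
  fixes X :: "'b::{conjugatable_field, real_normed_field, euclidean_space} ^ 'p ^ 'q"
  assumes "\<And>r. conjugate (of_real r :: 'b) = of_real r" and ind: "indep_three S W G"
  shows "random_variable borel (\<lambda>\<omega>. kron_sketch (S \<omega>) (W \<omega>) (G \<omega>) X)"
proof -
  have [measurable]: "random_variable borel S" "random_variable borel W" "random_variable borel G"
    using ind by (auto simp: indep_three_def)
  have SWG: "random_variable borel (\<lambda>\<omega>. (S \<omega>, W \<omega>, G \<omega>))"
    by (simp only: borel_prod[symmetric]) measurable
  have "(\<lambda>p. real_kron_sketch (fst p) (fst (snd p)) (snd (snd p)) X) \<in> borel_measurable borel"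
    unfolding real_kron_sketch_def by (intro borel_measurable_continuous_onI continuous_intros)
  from measurable_compose[OF SWG this] show ?thesis
    using assms(1) by (simp add: kron_sketch_eq_real)
qed

lemma conjugate_of_real [simp]:
  "conjugate (of_real r :: real) = of_real r" "conjugate (of_real r :: complex) = of_real r"
  by (simp_all add: conjugate_real_def conjugate_complex_def)

lemma cnj_sgn_mult: "cnj (sgn z) * z = of_real (cmod z)"
proof -
  have "cnj (sgn z) * z = (z * cnj z) / of_real (cmod z)"
    by (simp add: sgn_eq)
  also have "\<dots> = of_real ((cmod z)\<^sup>2) / of_real (cmod z)"
    by (simp only: complex_norm_square)
  also have "\<dots> = of_real (cmod z)"
    by (simp add: power2_eq_square)
  finally show ?thesis .
qed

text \<open>
  The real inner product is the real part of the complex one. A sesquilinear defect is turned into its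
  absolute value by replacing \<open>y\<close> with \<open>c y\<close> for a suitable \<open>c\<close> of modulus \<open>1\<close>, which
  stays in \<open>V\<close> and does not change the norm.
\<close>

lemma hermitian_defect_le_iff:
  fixes V :: "(complex ^ 'p ^ 'q) set" and T :: "complex ^ 'p ^ 'q \<Rightarrow> complex ^ 'k"
  assumes V: "\<And>c x. x \<in> V \<Longrightarrow> mat_scale c x \<in> V" and T: "\<And>c x. T (mat_scale c x) = c *s T x"
  shows "(\<forall>x\<in>V. \<forall>y\<in>V. cmod (frobenius_inner x y - canonical_inner (T x) (T y)) \<le> e * norm x * norm y)
    \<longleftrightarrow> (\<forall>x\<in>V. \<forall>y\<in>V. \<bar>x \<bullet> y - T x \<bullet> T y\<bar> \<le> e * norm x * norm y)"
proof (intro iffI ballI)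
  fix x y
  let ?D = "\<lambda>y. frobenius_inner x y - canonical_inner (T x) (T y)"
  have Re: "Re (?D y) = x \<bullet> y - T x \<bullet> T y" for y
    by (simp add: Re_frobenius_inner Re_canonical_inner)
  assume xy: "x \<in> V" "y \<in> V"
  {
    assume "\<forall>x\<in>V. \<forall>y\<in>V. cmod (frobenius_inner x y - canonical_inner (T x) (T y)) \<le> e * norm x * norm y"
    then have "cmod (?D y) \<le> e * norm x * norm y" using xy by blast
    then show "\<bar>x \<bullet> y - T x \<bullet> T y\<bar> \<le> e * norm x * norm y"
      using abs_Re_le_cmod[of "?D y"] unfolding Re by linarith
  next
    assume H: "\<forall>x\<in>V. \<forall>y\<in>V. \<bar>x \<bullet> y - T x \<bullet> T y\<bar> \<le> e * norm x * norm y"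
    show "cmod (?D y) \<le> e * norm x * norm y"
    proof (cases "?D y = 0")
      case True
      have "0 \<le> e * norm x * norm y" using H xy by (meson abs_ge_zero order_trans)
      then show ?thesis using True by simp
    next
      case False
      define c where "c = cnj (sgn (?D y))"
      have c: "norm c = 1" using False by (simp add: c_def norm_sgn)
      have "?D (mat_scale c y) = c * ?D y"
        by (simp add: frobenius_inner_mat_scale_right T canonical_inner_scale_right right_diff_distrib)
      also have "\<dots> = of_real (cmod (?D y))"
        unfolding c_def by (rule cnj_sgn_mult)
      finally have "cmod (?D y) = Re (?D (mat_scale c y))" by simp
      also have "\<dots> \<le> \<bar>x \<bullet> mat_scale c y - T x \<bullet> T (mat_scale c y)\<bar>"
        unfolding Re by (rule abs_ge_self)
      also have "\<dots> \<le> e * norm x * norm (mat_scale c y)" using H xy V by blast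
      finally show ?thesis using c by (simp add: norm_mat_scale)
    qed
  }
qed

theorem proposition3p7:
  fixes M :: "'w measure"
    and \<Sigma> :: "'w \<Rightarrow> real ^ 'p ^ 'k"
    and \<Omega> :: "'w \<Rightarrow> real ^ 'q ^ 'k"
    and \<Gamma> :: "'w \<Rightarrow> real ^ ('k \<times> 'k) ^ 'k"
    and \<epsilon> \<delta> :: real
    and d :: nat
  assumes "prob_space M"
    and "prob_space.rescaled_gaussian M \<Sigma>"
    and "prob_space.rescaled_gaussian M \<Omega>"
    and "prob_space.rescaled_gaussian M \<Gamma>"
    and "prob_space.indep_three M \<Sigma> \<Omega> \<Gamma>"
    and "d \<ge> 1"
    and "0 < \<epsilon>" "\<epsilon> < 1"
    and "0 < \<delta>" "\<delta> < 1"
  shows "(real CARD('k) \<ge> 168 / \<epsilon>\<^sup>2 * (6.9 * 1 * real d + ln (6 / \<delta>)) \<longrightarrow>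
           prob_space.oblivious_subspace_embedding M
             (mat_scale :: real \<Rightarrow> real ^ 'p ^ 'q \<Rightarrow> real ^ 'p ^ 'q) frobenius_inner
             \<epsilon> \<delta> d (\<lambda>\<omega>. kron_sketch (\<Sigma> \<omega>) (\<Omega> \<omega>) (\<Gamma> \<omega>))) \<and>
         (real CARD('k) \<ge> 168 / \<epsilon>\<^sup>2 * (6.9 * 2 * real d + ln (6 / \<delta>)) \<longrightarrow>
           prob_space.oblivious_subspace_embedding M
             (mat_scale :: complex \<Rightarrow> complex ^ 'p ^ 'q \<Rightarrow> complex ^ 'p ^ 'q) frobenius_inner
             \<epsilon> \<delta> d (\<lambda>\<omega>. kron_sketch (\<Sigma> \<omega>) (\<Omega> \<omega>) (\<Gamma> \<omega>)))"
proof -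
  interpret prob_space M by fact
  note gauss = assms(2-4) and ind = assms(5) and \<epsilon> = assms(7,8) and \<delta> = assms(9,10)
  let ?K = "\<lambda>\<omega>. kron_sketch (\<Sigma> \<omega>) (\<Omega> \<omega>) (\<Gamma> \<omega>)"
  show ?thesis
  proof (intro conjI impI)
    assume k: "real CARD('k) \<ge> 168 / \<epsilon>\<^sup>2 * (6.9 * 1 * real d + ln (6 / \<delta>))"
    have scale: "(mat_scale :: real \<Rightarrow> real ^ 'p ^ 'q \<Rightarrow> _) = (*\<^sub>R)"
      by (intro ext) (simp add: mat_scale_def map_matrix_def vec_eq_iff)
    show "oblivious_subspace_embedding (mat_scale :: real \<Rightarrow> real ^ 'p ^ 'q \<Rightarrow> real ^ 'p ^ 'q)
        frobenius_inner \<epsilon> \<delta> d ?K"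
      unfolding oblivious_subspace_embedding_def
    proof (intro conjI ballI allI impI)
      show "Vector_Spaces.linear mat_scale (*s) (?K \<omega> :: real ^ 'p ^ 'q \<Rightarrow> _)" for \<omega>
        by (rule linear_kron_sketch) simp
      show "random_variable borel (\<lambda>\<omega>. ?K \<omega> X)" for X :: "real ^ 'p ^ 'q"
        by (rule kron_sketch_measurable[OF _ ind]) simp
      fix V :: "(real ^ 'p ^ 'q) set"
      assume "module.subspace mat_scale V \<and> vector_space.dim mat_scale V = d"
      then have V: "subspace V" "dim V \<le> d"
        by (simp_all add: scale subspace_raw_def dim_raw_def)
      have "prob {\<omega> \<in> space M. \<forall>x\<in>V. \<forall>y\<in>V.
          \<bar>x \<bullet> y - real_kron_sketch (\<Sigma> \<omega>) (\<Omega> \<omega>) (\<Gamma> \<omega>) x \<bullet> real_kron_sketch (\<Sigma> \<omega>) (\<Omega> \<omega>) (\<Gamma> \<omega>) y\<bar>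
            \<le> \<epsilon> * norm x * norm y} \<ge> 1 - \<delta>"
        using k by (intro real_kron_sketch_embedding[OF gauss ind \<epsilon> \<delta> V]) simp
      then show "1 - \<delta> \<le> prob {\<omega> \<in> space M. \<forall>x\<in>V. \<forall>y\<in>V.
          norm (frobenius_inner x y - canonical_inner (?K \<omega> x) (?K \<omega> y))
            \<le> \<epsilon> * induced_norm frobenius_inner x * induced_norm frobenius_inner y}"
        unfolding induced_norm_frobenius_real frobenius_inner_real canonical_inner_real real_norm_def
        by (simp add: kron_sketch_eq_real)
    qed
  next
    assume k: "real CARD('k) \<ge> 168 / \<epsilon>\<^sup>2 * (6.9 * 2 * real d + ln (6 / \<delta>))"
    show "oblivious_subspace_embedding (mat_scale :: complex \<Rightarrow> complex ^ 'p ^ 'q \<Rightarrow> complex ^ 'p ^ 'q)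
        frobenius_inner \<epsilon> \<delta> d ?K"
      unfolding oblivious_subspace_embedding_def
    proof (intro conjI ballI allI impI)
      show "Vector_Spaces.linear mat_scale (*s) (?K \<omega> :: complex ^ 'p ^ 'q \<Rightarrow> _)" for \<omega>
        by (rule linear_kron_sketch) simp
      show "random_variable borel (\<lambda>\<omega>. ?K \<omega> X)" for X :: "complex ^ 'p ^ 'q"
        by (rule kron_sketch_measurable[OF _ ind]) simp
      fix V :: "(complex ^ 'p ^ 'q) set"
      assume V: "module.subspace mat_scale V \<and> vector_space.dim mat_scale V = d"
      interpret cvs: vector_space "mat_scale :: complex \<Rightarrow> complex ^ 'p ^ 'q \<Rightarrow> _"
        by (rule vector_space_mat_scale)
      have stable: "mat_scale c x \<in> V" if "x \<in> V" for c x
        using V that by (blast intro: cvs.subspace_scale)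
      have "prob {\<omega> \<in> space M. \<forall>x\<in>V. \<forall>y\<in>V.
          \<bar>x \<bullet> y - real_kron_sketch (\<Sigma> \<omega>) (\<Omega> \<omega>) (\<Gamma> \<omega>) x \<bullet> real_kron_sketch (\<Sigma> \<omega>) (\<Omega> \<omega>) (\<Gamma> \<omega>) y\<bar>
            \<le> \<epsilon> * norm x * norm y} \<ge> 1 - \<delta>"
        using k V assms(6)
        by (intro real_kron_sketch_embedding[OF gauss ind \<epsilon> \<delta>, where m = "2 * d"]
            complex_subspace_imp_real_subspace) (simp_all add: mult.assoc)
      moreover have "(\<forall>x\<in>V. \<forall>y\<in>V. cmod (frobenius_inner x y - canonical_inner (?K \<omega> x) (?K \<omega> y))
            \<le> \<epsilon> * norm x * norm y)
          \<longleftrightarrow> (\<forall>x\<in>V. \<forall>y\<in>V. \<bar>x \<bullet> y - ?K \<omega> x \<bullet> ?K \<omega> y\<bar> \<le> \<epsilon> * norm x * norm y)" for \<omega>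
        by (rule hermitian_defect_le_iff) (simp_all add: stable kron_sketch_mat_scale)
      ultimately show "1 - \<delta> \<le> prob {\<omega> \<in> space M. \<forall>x\<in>V. \<forall>y\<in>V.
          norm (frobenius_inner x y - canonical_inner (?K \<omega> x) (?K \<omega> y))
            \<le> \<epsilon> * induced_norm frobenius_inner x * induced_norm frobenius_inner y}"
        by (simp add: induced_norm_frobenius_complex kron_sketch_eq_real)
    qed
  qed
qed

end
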